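(* Let $A$ be a unitary ring. The following are equivalent for a torsion class $\mathcal{T}$ in $\mathrm{Mod}(A)$: (1) for every $A$-module $M$ there is an exact sequence $$M\xrightarrow{\ \phi\ } B\to C\to 0$$ such that $\phi$ is a left $\mathcal{T}$-approximation and $C$ is Ext-projective in $\mathcal{T}$; (2) there is a finendo quasitilting $A$-module $T$ such that $\mathcal{T}=\mathrm{Gen}(T)$.
   Context: $A$ is a unitary ring; modules are right $A$-modules, not necessarily finitely generated. $\mathrm{Add}(M)$ is the class of direct summands of arbitrary direct sums of copies of $M$; $\mathrm{Gen}(M)$ is the class of epimorphic images of modules in $\mathrm{Add}(M)$; $\mathrm{Pres}(M)$ is the class of modules $N$ admitting an exact sequence $M_1\to M_0\to N\to 0$ with $M_0,M_1\in\mathrm{Add}(M)$. A module $M\in\mathcal{T}$ is Ext-projective in $\mathcal{T}$ if $\mathrm{Ext}^1_A(M,N)=0$ for all $N\in\mathcal{T}$. A module $T$ is quasitilting if $\mathrm{Pres}(T)=\mathrm{Gen}(T)$ and $T$ is Ext-projective in $\mathrm{Gen}(T)$. A module is finendo if it is finitely generated over its endomorphism ring. A left $\mathcal{T}$-approximation of $M$ is a morphism $\phi:M\to B$ with $B\in\mathcal{T}$ such that every morphism from $M$ to an object of $\mathcal{T}$ factors through $\phi$. *)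

theory Defs
  imports "HOL-Algebra.Ring"
begin

unbundle cardinal_syntax

section \<open>Right modules over a unital, not necessarily commutative ring\<close>

text \<open>
  The modules of \<open>HOL-Algebra.Module\<close> are modules over a commutative ring, hence the
  definitions below. As there, the record inherits the fields \<open>mult\<close> and \<open>one\<close> of
  \<open>'b ring\<close>, which play no role.
\<close>

record ('a, 'b) rmodule = "'b ring" +
  ract :: "'b \<Rightarrow> 'a \<Rightarrow> 'b" (infixl \<open>\<odot>\<index>\<close> 70)

locale right_module = R: ring R + M: abelian_group M
  for R :: "'a ring" and M :: "('a, 'b) rmodule" (structure) +
  assumes ract_closed: "x \<in> carrier M \<Longrightarrow> a \<in> carrier R \<Longrightarrow> x \<odot> a \<in> carrier M"
    and ract_add: "x \<in> carrier M \<Longrightarrow> a \<in> carrier R \<Longrightarrow> b \<in> carrier R \<Longrightarrow>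
      x \<odot> (a \<oplus>\<^bsub>R\<^esub> b) = x \<odot> a \<oplus> x \<odot> b"
    and add_ract: "x \<in> carrier M \<Longrightarrow> y \<in> carrier M \<Longrightarrow> a \<in> carrier R \<Longrightarrow>
      (x \<oplus> y) \<odot> a = x \<odot> a \<oplus> y \<odot> a"
    and ract_mult: "x \<in> carrier M \<Longrightarrow> a \<in> carrier R \<Longrightarrow> b \<in> carrier R \<Longrightarrow>
      x \<odot> (a \<otimes>\<^bsub>R\<^esub> b) = (x \<odot> a) \<odot> b"
    and ract_one: "x \<in> carrier M \<Longrightarrow> x \<odot> \<one>\<^bsub>R\<^esub> = x"

definition rhom :: "'a ring \<Rightarrow> ('a, 'b) rmodule \<Rightarrow> ('a, 'c) rmodule \<Rightarrow> ('b \<Rightarrow> 'c) set" where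
  "rhom R M N = {f \<in> carrier M \<rightarrow> carrier N.
     (\<forall>x\<in>carrier M. \<forall>y\<in>carrier M. f (x \<oplus>\<^bsub>M\<^esub> y) = f x \<oplus>\<^bsub>N\<^esub> f y) \<and>
     (\<forall>x\<in>carrier M. \<forall>a\<in>carrier R. f (x \<odot>\<^bsub>M\<^esub> a) = f x \<odot>\<^bsub>N\<^esub> a)}"

definition riso :: "'a ring \<Rightarrow> ('a, 'b) rmodule \<Rightarrow> ('a, 'c) rmodule \<Rightarrow> ('b \<Rightarrow> 'c) set" where
  "riso R M N = {f \<in> rhom R M N. bij_betw f (carrier M) (carrier N)}"

definition repi :: "'a ring \<Rightarrow> ('a, 'b) rmodule \<Rightarrow> ('a, 'c) rmodule \<Rightarrow> ('b \<Rightarrow> 'c) set" where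
  "repi R M N = {f \<in> rhom R M N. f ` carrier M = carrier N}"

definition rkernel :: "('a, 'b) rmodule \<Rightarrow> ('a, 'c) rmodule \<Rightarrow> ('b \<Rightarrow> 'c) \<Rightarrow> 'b set" where
  "rkernel M N f = {x \<in> carrier M. f x = \<zero>\<^bsub>N\<^esub>}"

text \<open>Exactness of \<open>L \<rightarrow> M \<rightarrow> N \<rightarrow> 0\<close> and of \<open>0 \<rightarrow> L \<rightarrow> M \<rightarrow> N \<rightarrow> 0\<close>.\<close>

definition right_exact ::
  "'a ring \<Rightarrow> ('a, 'b) rmodule \<Rightarrow> ('b \<Rightarrow> 'c) \<Rightarrow> ('a, 'c) rmodule \<Rightarrow> ('c \<Rightarrow> 'd) \<Rightarrow> ('a, 'd) rmodule \<Rightarrow> bool"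
  where "right_exact R L f M g N \<longleftrightarrow>
    f \<in> rhom R L M \<and> g \<in> repi R M N \<and> f ` carrier L = rkernel M N g"

definition short_exact ::
  "'a ring \<Rightarrow> ('a, 'b) rmodule \<Rightarrow> ('b \<Rightarrow> 'c) \<Rightarrow> ('a, 'c) rmodule \<Rightarrow> ('c \<Rightarrow> 'd) \<Rightarrow> ('a, 'd) rmodule \<Rightarrow> bool"
  where "short_exact R L f M g N \<longleftrightarrow> right_exact R L f M g N \<and> inj_on f (carrier L)"

definition direct_sum :: "'i set \<Rightarrow> ('i \<Rightarrow> ('a, 'b) rmodule) \<Rightarrow> ('a, 'i \<Rightarrow> 'b) rmodule" where
  "direct_sum I F = \<lparr>
     carrier = {x \<in> (\<Pi>\<^sub>E i\<in>I. carrier (F i)). finite {i \<in> I. x i \<noteq> \<zero>\<^bsub>F i\<^esub>}},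
     mult = undefined, one = undefined,
     zero = (\<lambda>i\<in>I. \<zero>\<^bsub>F i\<^esub>),
     add = (\<lambda>x y. \<lambda>i\<in>I. x i \<oplus>\<^bsub>F i\<^esub> y i),
     ract = (\<lambda>x a. \<lambda>i\<in>I. x i \<odot>\<^bsub>F i\<^esub> a)\<rparr>"

definition direct_sum2 :: "('a, 'b) rmodule \<Rightarrow> ('a, 'c) rmodule \<Rightarrow> ('a, 'b \<times> 'c) rmodule" where
  "direct_sum2 M N = \<lparr>
     carrier = carrier M \<times> carrier N,
     mult = undefined, one = undefined,
     zero = (\<zero>\<^bsub>M\<^esub>, \<zero>\<^bsub>N\<^esub>),
     add = (\<lambda>(x, y) (x', y'). (x \<oplus>\<^bsub>M\<^esub> x', y \<oplus>\<^bsub>N\<^esub> y')),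
     ract = (\<lambda>(x, y) a. (x \<odot>\<^bsub>M\<^esub> a, y \<odot>\<^bsub>N\<^esub> a))\<rparr>"

section \<open>The module category\<close>

text \<open>
  A class of modules closed under arbitrary direct sums does not fit into a single HOL type
  unless ``arbitrary'' is read relative to a universe. The universe is a type \<open>'u\<close>: a set is
  small if its cardinality is below that of \<open>'u\<close>, and the module category consists of the
  modules with a small carrier in \<open>'u\<close>. For \<open>'u\<close> of inaccessible cardinality this is the
  category of modules in a Grothendieck universe. Only what is needed for the ring to be
  small and for small direct sums of small modules to be small is required of \<open>'u\<close>, so that
  suitable types exist in HOL for every ring (any uncountable successor cardinal above the
  ring will do).
\<close>

definition small :: "'u set \<Rightarrow> bool" where
  "small X \<longleftrightarrow> |X| <o |UNIV :: 'u set|"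

definition module_universe :: "'a ring \<Rightarrow> 'u itself \<Rightarrow> bool" where
  "module_universe R U \<longleftrightarrow>
     regularCard |UNIV :: 'u set| \<and> natLeq <o |UNIV :: 'u set| \<and> |carrier R| <o |UNIV :: 'u set|"

definition Mod :: "'a ring \<Rightarrow> ('a, 'u) rmodule set" where
  "Mod R = {M. right_module R M \<and> small (carrier M)}"

definition torsion_class :: "'a ring \<Rightarrow> ('a, 'u) rmodule set \<Rightarrow> bool" where
  "torsion_class R \<T> \<longleftrightarrow> \<T> \<subseteq> Mod R \<and>
     (\<forall>M\<in>\<T>. \<forall>N\<in>Mod R. repi R M N \<noteq> {} \<longrightarrow> N \<in> \<T>) \<and>
     (\<forall>L\<in>\<T>. \<forall>N\<in>\<T>. \<forall>M\<in>Mod R. (\<exists>f g. short_exact R L f M g N) \<longrightarrow> M \<in> \<T>) \<and>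
     (\<forall>(I :: 'u set) F. small I \<longrightarrow> (\<forall>i\<in>I. F i \<in> \<T>) \<longrightarrow>
        (\<forall>M\<in>Mod R. riso R (direct_sum I F) M \<noteq> {} \<longrightarrow> M \<in> \<T>))"

definition Add :: "'a ring \<Rightarrow> ('a, 'u) rmodule \<Rightarrow> ('a, 'u) rmodule set" where
  "Add R M = {N \<in> Mod R. \<exists>N'\<in>(Mod R :: ('a, 'u) rmodule set). \<exists>I :: 'u set. small I \<and>
     riso R (direct_sum2 N N') (direct_sum I (\<lambda>_. M)) \<noteq> {}}"

definition Gen :: "'a ring \<Rightarrow> ('a, 'u) rmodule \<Rightarrow> ('a, 'u) rmodule set" where
  "Gen R M = {N \<in> Mod R. \<exists>X\<in>Add R M. repi R X N \<noteq> {}}"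

definition Pres :: "'a ring \<Rightarrow> ('a, 'u) rmodule \<Rightarrow> ('a, 'u) rmodule set" where
  "Pres R M = {N \<in> Mod R. \<exists>M1\<in>Add R M. \<exists>M0\<in>Add R M. \<exists>f g. right_exact R M1 f M0 g N}"

section \<open>Extensions\<close>

text \<open>
  \<open>Ext1 R M N\<close> is the set of equivalence classes of short exact sequences
  \<open>0 \<rightarrow> N \<rightarrow> E \<rightarrow> M \<rightarrow> 0\<close> (Yoneda). The zero element of this group for the Baer sum is the class
  of \<open>0 \<rightarrow> N \<rightarrow> N \<oplus> M \<rightarrow> M \<rightarrow> 0\<close>; the carrier of \<open>direct_sum2 N M\<close> is of type \<open>'u \<times> 'u\<close>, so this class
  is given by the extensions in \<open>'u\<close> equivalent to that sequence.
\<close>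

type_synonym ('a, 'u, 'e) extension = "('a, 'e) rmodule \<times> ('u \<Rightarrow> 'e) \<times> ('e \<Rightarrow> 'u)"

definition extensions ::
  "'a ring \<Rightarrow> ('a, 'u) rmodule \<Rightarrow> ('a, 'u) rmodule \<Rightarrow> ('a, 'u, 'u) extension set" where
  "extensions R M N = {(E, f, g). E \<in> Mod R \<and> short_exact R N f E g M}"

definition ext_equiv ::
  "'a ring \<Rightarrow> ('a, 'u) rmodule \<Rightarrow> ('a, 'u, 'e) extension \<Rightarrow> ('a, 'u, 'f) extension \<Rightarrow> bool" where
  "ext_equiv R N = (\<lambda>(E, f, g) (E', f', g'). \<exists>h\<in>riso R E E'.
     (\<forall>x\<in>carrier N. h (f x) = f' x) \<and> (\<forall>y\<in>carrier E. g' (h y) = g y))"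

definition Ext1 ::
  "'a ring \<Rightarrow> ('a, 'u) rmodule \<Rightarrow> ('a, 'u) rmodule \<Rightarrow> ('a, 'u, 'u) extension set set" where
  "Ext1 R M N = extensions R M N //
     {(e, e'). e \<in> extensions R M N \<and> e' \<in> extensions R M N \<and> ext_equiv R N e e'}"

definition Ext1_zero ::
  "'a ring \<Rightarrow> ('a, 'u) rmodule \<Rightarrow> ('a, 'u) rmodule \<Rightarrow> ('a, 'u, 'u) extension set" where
  "Ext1_zero R M N = {e \<in> extensions R M N.
     ext_equiv R N e (direct_sum2 N M, (\<lambda>x. (x, \<zero>\<^bsub>M\<^esub>)), snd)}"

definition Ext_projective :: "'a ring \<Rightarrow> ('a, 'u) rmodule set \<Rightarrow> ('a, 'u) rmodule \<Rightarrow> bool" where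
  "Ext_projective R \<T> M \<longleftrightarrow> M \<in> \<T> \<and> (\<forall>N\<in>\<T>. Ext1 R M N = {Ext1_zero R M N})"

section \<open>Approximations and quasitilting modules\<close>

definition left_approximation ::
  "'a ring \<Rightarrow> ('a, 'u) rmodule set \<Rightarrow> ('a, 'u) rmodule \<Rightarrow> ('u \<Rightarrow> 'u) \<Rightarrow> ('a, 'u) rmodule \<Rightarrow> bool" where
  "left_approximation R \<T> M \<phi> B \<longleftrightarrow> B \<in> \<T> \<and> \<phi> \<in> rhom R M B \<and>
     (\<forall>N\<in>\<T>. \<forall>f\<in>rhom R M N. \<exists>g\<in>rhom R B N. \<forall>x\<in>carrier M. f x = g (\<phi> x))"

definition quasitilting :: "'a ring \<Rightarrow> ('a, 'u) rmodule \<Rightarrow> bool" where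
  "quasitilting R T \<longleftrightarrow> T \<in> Mod R \<and> Pres R T = Gen R T \<and> Ext_projective R (Gen R T) T"

text \<open>Finite generation of \<open>T\<close> as a left module over its endomorphism ring.\<close>

definition finendo :: "'a ring \<Rightarrow> ('a, 'u) rmodule \<Rightarrow> bool" where
  "finendo R T \<longleftrightarrow> (\<exists>X. finite X \<and> X \<subseteq> carrier T \<and>
     (\<forall>t\<in>carrier T. \<exists>h \<in> X \<rightarrow> rhom R T T. t = (\<Oplus>\<^bsub>T\<^esub>x\<in>X. h x x)))"

end

theory Submission
  imports Defs
begin

text \<open>
  Write \<open>A \<rightarrow> T0 \<rightarrow> T1 \<rightarrow> 0\<close> for an approximation sequence of the regular module and \<open>x\<close> for the image of
  \<open>1\<close> in \<open>T0\<close>. The approximation property says that every element of every torsion module is the value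
  at \<open>x\<close> of a homomorphism from \<open>T0\<close>; such an element is called \<^emph>\<open>versal\<close> below. Both conditions of the
  theorem are equivalent to the existence of a versal element in an Ext-projective module.

  From (1) to (2), the module is \<open>T = T0 \<oplus> T1\<close>. That \<open>T0\<close> is Ext-projective follows from the versal
  element and from \<open>T1 = T0 / x A\<close> being Ext-projective (\<open>versal_Ext_projective\<close>), and \<open>T\<close> is generated by \<open>x\<close>
  over its endomorphism ring. The main point is that every torsion module has a presentation by
  modules in \<open>Add T\<close> (\<open>presentation\<close>); this gives \<open>\<T> \<subseteq> Pres T \<subseteq> Gen T \<subseteq> \<T>\<close>. It is done by an
  explicit choice of maps, with index sets that are subsets of torsion modules, because sets of
  homomorphisms between small modules need not be small.

  From (2) to (1), a finite generating set of \<open>T\<close> over its endomorphism ring is a versal element of a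
  finite power of \<open>T\<close> (\<open>versal_from_finendo\<close>). From a versal element, approximations of all modules are
  obtained by generators and relations (\<open>approximation_from_versal\<close>).

  Two reductions carry the technical side. The vanishing of \<open>Ext\<close> is only used through the splitting of
  extensions and through the lifting property against epimorphisms with torsion kernel
  (\<open>Ext_projective_iff_split\<close>, \<open>Ext_projective_lift\<close>). Direct sums are only used through
  their universal property and through generation by the summands (\<open>coproduct\<close>), so that every module can be
  replaced by an isomorphic one inside the universe.
\<close>

section \<open>Modules and homomorphisms\<close>

lemma right_moduleI:
  fixes R :: "'a ring" and M :: "('a, 'b) rmodule" (structure)
  assumes "ring R"
    and "\<And>x y. x \<in> carrier M \<Longrightarrow> y \<in> carrier M \<Longrightarrow> x \<oplus> y \<in> carrier M"
    and "\<zero> \<in> carrier M"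
    and "\<And>x y z. x \<in> carrier M \<Longrightarrow> y \<in> carrier M \<Longrightarrow> z \<in> carrier M \<Longrightarrow> (x \<oplus> y) \<oplus> z = x \<oplus> (y \<oplus> z)"
    and "\<And>x y. x \<in> carrier M \<Longrightarrow> y \<in> carrier M \<Longrightarrow> x \<oplus> y = y \<oplus> x"
    and "\<And>x. x \<in> carrier M \<Longrightarrow> \<zero> \<oplus> x = x"
    and "\<And>x. x \<in> carrier M \<Longrightarrow> \<exists>y \<in> carrier M. y \<oplus> x = \<zero>"
    and "\<And>x a. x \<in> carrier M \<Longrightarrow> a \<in> carrier R \<Longrightarrow> x \<odot> a \<in> carrier M"
    and "\<And>x a b. x \<in> carrier M \<Longrightarrow> a \<in> carrier R \<Longrightarrow> b \<in> carrier R \<Longrightarrow>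
      x \<odot> (a \<oplus>\<^bsub>R\<^esub> b) = x \<odot> a \<oplus> x \<odot> b"
    and "\<And>x y a. x \<in> carrier M \<Longrightarrow> y \<in> carrier M \<Longrightarrow> a \<in> carrier R \<Longrightarrow>
      (x \<oplus> y) \<odot> a = x \<odot> a \<oplus> y \<odot> a"
    and "\<And>x a b. x \<in> carrier M \<Longrightarrow> a \<in> carrier R \<Longrightarrow> b \<in> carrier R \<Longrightarrow>
      x \<odot> (a \<otimes>\<^bsub>R\<^esub> b) = (x \<odot> a) \<odot> b"
    and "\<And>x. x \<in> carrier M \<Longrightarrow> x \<odot> \<one>\<^bsub>R\<^esub> = x"
  shows "right_module R M"
  using assms by (intro right_module.intro right_module_axioms.intro abelian_groupI) auto

context right_module
begin

lemma minus_zero: "\<ominus> \<zero> = \<zero>"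
  by (metis M.l_zero M.zero_closed M.minus_equality)

lemma minus_eq_zero_iff: "x \<in> carrier M \<Longrightarrow> y \<in> carrier M \<Longrightarrow> x \<ominus> y = \<zero> \<longleftrightarrow> x = y"
  by (metis M.minus_eq M.r_neg M.a_inv_closed M.minus_equality M.minus_minus)

lemma zero_ract [simp]: "a \<in> carrier R \<Longrightarrow> \<zero> \<odot> a = \<zero>"
  using add_ract[of \<zero> \<zero> a] ract_closed[of \<zero> a] M.add.l_cancel_one M.zero_closed by fastforce

lemma neg_ract: "x \<in> carrier M \<Longrightarrow> a \<in> carrier R \<Longrightarrow> (\<ominus> x) \<odot> a = \<ominus> (x \<odot> a)"
  using add_ract[of "\<ominus> x" x a]
  by (intro M.minus_equality[symmetric]) (auto simp: ract_closed M.l_neg)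

end

lemma rhomI:
  assumes "\<And>x. x \<in> carrier M \<Longrightarrow> f x \<in> carrier N"
    and "\<And>x y. x \<in> carrier M \<Longrightarrow> y \<in> carrier M \<Longrightarrow> f (x \<oplus>\<^bsub>M\<^esub> y) = f x \<oplus>\<^bsub>N\<^esub> f y"
    and "\<And>x a. x \<in> carrier M \<Longrightarrow> a \<in> carrier R \<Longrightarrow> f (x \<odot>\<^bsub>M\<^esub> a) = f x \<odot>\<^bsub>N\<^esub> a"
  shows "f \<in> rhom R M N"
  using assms by (auto simp: rhom_def)

lemma rhom_closed: "f \<in> rhom R M N \<Longrightarrow> x \<in> carrier M \<Longrightarrow> f x \<in> carrier N"
  and rhom_add: "f \<in> rhom R M N \<Longrightarrow> x \<in> carrier M \<Longrightarrow> y \<in> carrier M \<Longrightarrow>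
    f (x \<oplus>\<^bsub>M\<^esub> y) = f x \<oplus>\<^bsub>N\<^esub> f y"
  and rhom_ract: "f \<in> rhom R M N \<Longrightarrow> x \<in> carrier M \<Longrightarrow> a \<in> carrier R \<Longrightarrow>
    f (x \<odot>\<^bsub>M\<^esub> a) = f x \<odot>\<^bsub>N\<^esub> a"
  by (auto simp: rhom_def)

lemma rhom_zero:
  assumes "right_module R M" "right_module R N" "f \<in> rhom R M N"
  shows "f \<zero>\<^bsub>M\<^esub> = \<zero>\<^bsub>N\<^esub>"
proof -
  interpret M: right_module R M by fact
  interpret N: right_module R N by fact
  show ?thesis
    using rhom_add[OF assms(3), of "\<zero>\<^bsub>M\<^esub>" "\<zero>\<^bsub>M\<^esub>"] rhom_closed[OF assms(3), of "\<zero>\<^bsub>M\<^esub>"]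
      N.M.add.l_cancel_one by fastforce
qed

lemma rhom_neg:
  assumes "right_module R M" "right_module R N" "f \<in> rhom R M N" "x \<in> carrier M"
  shows "f (\<ominus>\<^bsub>M\<^esub> x) = \<ominus>\<^bsub>N\<^esub> f x"
proof -
  interpret M: right_module R M by fact
  interpret N: right_module R N by fact
  show ?thesis
    using rhom_add[OF assms(3), of "\<ominus>\<^bsub>M\<^esub> x" x] rhom_closed[OF assms(3)] assms(4)
      rhom_zero[OF assms(1-3)]
    by (intro N.M.minus_equality[symmetric]) (auto simp: M.M.l_neg)
qed

lemma rhom_minus:
  assumes "right_module R M" "right_module R N" "f \<in> rhom R M N" "x \<in> carrier M" "y \<in> carrier M"
  shows "f (x \<ominus>\<^bsub>M\<^esub> y) = f x \<ominus>\<^bsub>N\<^esub> f y"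
proof -
  interpret M: right_module R M by fact
  show ?thesis
    using assms by (simp add: a_minus_def rhom_add[OF assms(3)] rhom_neg[OF assms(1-3)])
qed

lemma rhom_finsum:
  assumes "right_module R M" "right_module R N" "f \<in> rhom R M N" "finite X"
    and "\<And>x. x \<in> X \<Longrightarrow> u x \<in> carrier M"
  shows "f (\<Oplus>\<^bsub>M\<^esub>x\<in>X. u x) = (\<Oplus>\<^bsub>N\<^esub>x\<in>X. f (u x))"
proof -
  interpret M: right_module R M by fact
  interpret N: right_module R N by fact
  show ?thesis
    using assms(4,5)
  proof (induction X)
    case empty
    then show ?case by (simp add: rhom_zero[OF assms(1-3)])
  next
    case (insert x X)
    then show ?case
      by (simp add: rhom_add[OF assms(3)] rhom_closed[OF assms(3)] Pi_iff)
  qed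
qed

lemma rhom_id: "(\<lambda>x. x) \<in> rhom R M M"
  by (simp add: rhom_def)

lemma rhom_comp: "f \<in> rhom R L M \<Longrightarrow> g \<in> rhom R M N \<Longrightarrow> (\<lambda>x. g (f x)) \<in> rhom R L N"
  by (auto simp: rhom_def Pi_iff)

lemma rhom_plus:
  assumes "right_module R N" "f \<in> rhom R M N" "g \<in> rhom R M N"
  shows "(\<lambda>x. f x \<oplus>\<^bsub>N\<^esub> g x) \<in> rhom R M N"
proof -
  interpret N: right_module R N by fact
  show ?thesis
    using assms(2,3)
    by (intro rhomI) (auto simp: rhom_add rhom_ract rhom_closed N.add_ract N.M.a_ac)
qed

lemma rhom_diff:
  assumes "right_module R N" "f \<in> rhom R M N" "g \<in> rhom R M N"
  shows "(\<lambda>x. f x \<ominus>\<^bsub>N\<^esub> g x) \<in> rhom R M N"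
proof -
  interpret N: right_module R N by fact
  show ?thesis
    using assms(2,3)
    by (intro rhomI) (auto simp: rhom_add rhom_ract rhom_closed N.add_ract N.M.a_ac a_minus_def
        N.neg_ract N.M.minus_add)
qed

lemma rhom_const_zero:
  assumes "right_module R N"
  shows "(\<lambda>x. \<zero>\<^bsub>N\<^esub>) \<in> rhom R M N"
proof -
  interpret N: right_module R N by fact
  show ?thesis by (intro rhomI) auto
qed

lemma repi_comp: "f \<in> repi R L M \<Longrightarrow> g \<in> repi R M N \<Longrightarrow> (\<lambda>x. g (f x)) \<in> repi R L N"
  by (auto simp: repi_def rhom_comp image_image[symmetric])

lemma riso_repi: "riso R M N \<subseteq> repi R M N"
  by (auto simp: riso_def repi_def bij_betw_def)

lemma riso_inv:
  assumes "right_module R M" "f \<in> riso R M N"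
  shows "inv_into (carrier M) f \<in> riso R N M"
proof -
  interpret M: right_module R M by fact
  have f: "f \<in> rhom R M N" "inj_on f (carrier M)" "f ` carrier M = carrier N"
    using assms(2) by (auto simp: riso_def bij_betw_def)
  have 1: "inv_into (carrier M) f y \<in> carrier M" if "y \<in> carrier N" for y
    using f(3) that inv_into_into by metis
  have 2: "f (inv_into (carrier M) f y) = y" if "y \<in> carrier N" for y
    using f(3) that f_inv_into_f by metis
  have "inv_into (carrier M) f \<in> rhom R N M"
    by (intro rhomI 1 inv_into_f_eq[OF f(2)])
       (auto simp: 1 2 rhom_add[OF f(1)] rhom_ract[OF f(1)] M.ract_closed)
  then show ?thesis
    using assms(2) by (simp add: riso_def bij_betw_inv_into)
qed

lemma riso_comp: "f \<in> riso R L M \<Longrightarrow> g \<in> riso R M N \<Longrightarrow> (\<lambda>x. g (f x)) \<in> riso R L N"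
  by (auto simp: riso_def rhom_comp bij_betw_trans[unfolded comp_def])

text \<open>
  The module axioms are equations, apart from the existence of negatives, and all of them pass to
  the image under a surjection that respects the operations.
\<close>

lemma right_module_image:
  assumes "right_module R M" and surj: "r ` carrier M = carrier N"
    and zero: "r \<zero>\<^bsub>M\<^esub> = \<zero>\<^bsub>N\<^esub>"
    and add: "\<And>x y. x \<in> carrier M \<Longrightarrow> y \<in> carrier M \<Longrightarrow> r (x \<oplus>\<^bsub>M\<^esub> y) = r x \<oplus>\<^bsub>N\<^esub> r y"
    and act: "\<And>x a. x \<in> carrier M \<Longrightarrow> a \<in> carrier R \<Longrightarrow> r (x \<odot>\<^bsub>M\<^esub> a) = r x \<odot>\<^bsub>N\<^esub> a"
  shows "right_module R N"
proof -
  interpret M: right_module R M by fact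
  note eqs = zero[symmetric] add[symmetric] act[symmetric]
  have ball: "(\<forall>x\<in>carrier N. P x) \<longleftrightarrow> (\<forall>x\<in>carrier M. P (r x))" for P
    unfolding surj[symmetric] by simp
  have mem: "x \<in> carrier M \<Longrightarrow> r x \<in> carrier N" for x
    using surj by blast
  have "\<forall>x\<in>carrier N. \<forall>y\<in>carrier N. x \<oplus>\<^bsub>N\<^esub> y \<in> carrier N \<and> x \<oplus>\<^bsub>N\<^esub> y = y \<oplus>\<^bsub>N\<^esub> x"
    unfolding ball by (simp add: eqs mem M.M.a_comm)
  moreover have "\<forall>x\<in>carrier N. \<forall>y\<in>carrier N. \<forall>z\<in>carrier N. (x \<oplus>\<^bsub>N\<^esub> y) \<oplus>\<^bsub>N\<^esub> z = x \<oplus>\<^bsub>N\<^esub> (y \<oplus>\<^bsub>N\<^esub> z)"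
    unfolding ball by (simp add: eqs M.M.a_assoc)
  moreover have "\<forall>x\<in>carrier N. \<zero>\<^bsub>N\<^esub> \<oplus>\<^bsub>N\<^esub> x = x \<and> x \<odot>\<^bsub>N\<^esub> \<one>\<^bsub>R\<^esub> = x"
    unfolding ball by (simp add: eqs M.ract_one)
  moreover have "\<forall>x\<in>carrier N. \<exists>y\<in>carrier N. y \<oplus>\<^bsub>N\<^esub> x = \<zero>\<^bsub>N\<^esub>"
    unfolding ball
  proof
    fix x assume "x \<in> carrier M"
    then show "\<exists>y\<in>carrier N. y \<oplus>\<^bsub>N\<^esub> r x = \<zero>\<^bsub>N\<^esub>"
      by (intro bexI[of _ "r (\<ominus>\<^bsub>M\<^esub> x)"] mem) (simp_all add: eqs M.M.l_neg)
  qed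
  moreover have "\<forall>x\<in>carrier N. \<forall>a\<in>carrier R. x \<odot>\<^bsub>N\<^esub> a \<in> carrier N"
    unfolding ball by (simp add: eqs mem M.ract_closed)
  moreover have "\<forall>x\<in>carrier N. \<forall>a\<in>carrier R. \<forall>b\<in>carrier R.
      x \<odot>\<^bsub>N\<^esub> (a \<oplus>\<^bsub>R\<^esub> b) = x \<odot>\<^bsub>N\<^esub> a \<oplus>\<^bsub>N\<^esub> x \<odot>\<^bsub>N\<^esub> b \<and>
      x \<odot>\<^bsub>N\<^esub> (a \<otimes>\<^bsub>R\<^esub> b) = (x \<odot>\<^bsub>N\<^esub> a) \<odot>\<^bsub>N\<^esub> b"
    unfolding ball by (simp add: eqs M.ract_closed M.ract_add M.ract_mult)
  moreover have "\<forall>x\<in>carrier N. \<forall>y\<in>carrier N. \<forall>a\<in>carrier R.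
      (x \<oplus>\<^bsub>N\<^esub> y) \<odot>\<^bsub>N\<^esub> a = x \<odot>\<^bsub>N\<^esub> a \<oplus>\<^bsub>N\<^esub> y \<odot>\<^bsub>N\<^esub> a"
    unfolding ball by (simp add: eqs M.ract_closed M.add_ract)
  moreover have "\<zero>\<^bsub>N\<^esub> \<in> carrier N"
    using mem[of "\<zero>\<^bsub>M\<^esub>"] zero by simp
  ultimately show ?thesis
    by (intro right_moduleI M.R.ring_axioms) blast+
qed

text \<open>
  The structure that \<open>r\<close> pushes forward from \<open>M\<close> to \<open>r ` carrier M\<close>. An injective \<open>r\<close> gives a copy of
  \<open>M\<close> on another type; a choice of representatives of cosets gives a quotient of \<open>M\<close>.
\<close>

definition image_module :: "('b \<Rightarrow> 'c) \<Rightarrow> ('a, 'b) rmodule \<Rightarrow> ('a, 'c) rmodule" where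
  "image_module r M = \<lparr>
     carrier = r ` carrier M,
     mult = undefined, one = undefined,
     zero = r \<zero>\<^bsub>M\<^esub>,
     add = (\<lambda>u v. r (inv_into (carrier M) r u \<oplus>\<^bsub>M\<^esub> inv_into (carrier M) r v)),
     ract = (\<lambda>u a. r (inv_into (carrier M) r u \<odot>\<^bsub>M\<^esub> a))\<rparr>"

lemma image_module:
  assumes "right_module R M"
    and "\<And>x x' y y'. x \<in> carrier M \<Longrightarrow> x' \<in> carrier M \<Longrightarrow> y \<in> carrier M \<Longrightarrow> y' \<in> carrier M \<Longrightarrow>
      r x = r x' \<Longrightarrow> r y = r y' \<Longrightarrow> r (x \<oplus>\<^bsub>M\<^esub> y) = r (x' \<oplus>\<^bsub>M\<^esub> y')"
    and "\<And>x x' a. x \<in> carrier M \<Longrightarrow> x' \<in> carrier M \<Longrightarrow> a \<in> carrier R \<Longrightarrow>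
      r x = r x' \<Longrightarrow> r (x \<odot>\<^bsub>M\<^esub> a) = r (x' \<odot>\<^bsub>M\<^esub> a)"
  shows "right_module R (image_module r M)" and "r \<in> repi R M (image_module r M)"
proof -
  let ?s = "inv_into (carrier M) r"
  have s: "?s (r x) \<in> carrier M" "r (?s (r x)) = r x" if "x \<in> carrier M" for x
    using that by (auto intro: inv_into_into f_inv_into_f)
  have car: "r ` carrier M = carrier (image_module r M)"
    by (simp add: image_module_def)
  have add: "r (x \<oplus>\<^bsub>M\<^esub> y) = r x \<oplus>\<^bsub>image_module r M\<^esub> r y"
    if "x \<in> carrier M" "y \<in> carrier M" for x y
    unfolding image_module_def by simp (intro assms(2) s(1) s(2)[symmetric] that)
  have act: "r (x \<odot>\<^bsub>M\<^esub> a) = r x \<odot>\<^bsub>image_module r M\<^esub> a"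
    if "x \<in> carrier M" "a \<in> carrier R" for x a
    unfolding image_module_def by simp (intro assms(3) s(1) s(2)[symmetric] that)
  have zero: "r \<zero>\<^bsub>M\<^esub> = \<zero>\<^bsub>image_module r M\<^esub>"
    by (simp add: image_module_def)
  show "right_module R (image_module r M)"
    by (rule right_module_image[where r = r, OF assms(1)]) (fact car zero add act)+
  show "r \<in> repi R M (image_module r M)"
    unfolding repi_def using add act by (auto simp: car[symmetric] intro!: rhomI)
qed

lemma factor_through_epi:
  assumes "right_module R M" "right_module R Q" "right_module R N"
    and q: "q \<in> repi R M Q" and f: "f \<in> rhom R M N"
    and ker: "\<And>x. x \<in> carrier M \<Longrightarrow> q x = \<zero>\<^bsub>Q\<^esub> \<Longrightarrow> f x = \<zero>\<^bsub>N\<^esub>"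
  shows "\<exists>g\<in>rhom R Q N. \<forall>x\<in>carrier M. g (q x) = f x"
proof -
  interpret M: right_module R M by fact
  interpret Q: right_module R Q by fact
  interpret N: right_module R N by fact
  have qh: "q \<in> rhom R M Q" and qi: "q ` carrier M = carrier Q"
    using q by (auto simp: repi_def)
  let ?s = "inv_into (carrier M) q"
  have s: "?s y \<in> carrier M" "q (?s y) = y" if "y \<in> carrier Q" for y
    using that qi by (metis inv_into_into, metis f_inv_into_f)
  have eq: "f x = f y" if "x \<in> carrier M" "y \<in> carrier M" "q x = q y" for x y
  proof -
    have "q (x \<ominus>\<^bsub>M\<^esub> y) = \<zero>\<^bsub>Q\<^esub>"
      using that rhom_closed[OF qh]
      by (simp add: rhom_minus[OF assms(1,2) qh] Q.minus_eq_zero_iff)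
    then have "f x \<ominus>\<^bsub>N\<^esub> f y = \<zero>\<^bsub>N\<^esub>"
      using ker[of "x \<ominus>\<^bsub>M\<^esub> y"] that by (simp add: rhom_minus[OF assms(1,3) f])
    then show ?thesis
      using rhom_closed[OF f] that by (simp add: N.minus_eq_zero_iff)
  qed
  show ?thesis
  proof (intro bexI ballI)
    show "f (?s (q x)) = f x" if "x \<in> carrier M" for x
      by (rule eq) (use that s rhom_closed[OF qh] in auto)
    show "(\<lambda>y. f (?s y)) \<in> rhom R Q N"
    proof (rule rhomI)
      show "f (?s (x \<oplus>\<^bsub>Q\<^esub> y)) = f (?s x) \<oplus>\<^bsub>N\<^esub> f (?s y)" if "x \<in> carrier Q" "y \<in> carrier Q" for x y
        using that s by (subst rhom_add[OF f, symmetric]) (auto intro!: eq simp: rhom_add[OF qh])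
      show "f (?s (x \<odot>\<^bsub>Q\<^esub> a)) = f (?s x) \<odot>\<^bsub>N\<^esub> a" if "x \<in> carrier Q" "a \<in> carrier R" for x a
        using that s by (subst rhom_ract[OF f, symmetric])
          (auto intro!: eq simp: rhom_ract[OF qh] M.ract_closed Q.ract_closed)
    qed (use s rhom_closed[OF f] in auto)
  qed
qed

section \<open>Submodules and quotients\<close>

definition submodule :: "'a ring \<Rightarrow> ('a, 'b) rmodule \<Rightarrow> 'b set \<Rightarrow> bool" where
  "submodule R M S \<longleftrightarrow> S \<subseteq> carrier M \<and> \<zero>\<^bsub>M\<^esub> \<in> S \<and> (\<forall>x\<in>S. \<forall>y\<in>S. x \<oplus>\<^bsub>M\<^esub> y \<in> S) \<and>
     (\<forall>x\<in>S. \<ominus>\<^bsub>M\<^esub> x \<in> S) \<and> (\<forall>x\<in>S. \<forall>a\<in>carrier R. x \<odot>\<^bsub>M\<^esub> a \<in> S)"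

lemma submodule_right_module:
  assumes "right_module R M" "submodule R M S"
  shows "right_module R (M\<lparr>carrier := S\<rparr>)"
proof -
  interpret M: right_module R M by fact
  have S: "x \<in> carrier M" if "x \<in> S" for x
    using that assms(2) by (auto simp: submodule_def)
  have neg: "\<exists>y\<in>S. x \<oplus>\<^bsub>M\<^esub> y = \<zero>\<^bsub>M\<^esub>" if "x \<in> S" for x
    using that assms(2) S by (intro bexI[of _ "\<ominus>\<^bsub>M\<^esub> x"] M.M.r_neg) (auto simp: submodule_def)
  show ?thesis
    using assms(2)
    by (intro right_moduleI M.R.ring_axioms)
      (auto simp: submodule_def S M.M.a_ac M.ract_add M.add_ract M.ract_mult M.ract_one neg)
qed

lemma rkernel_submodule:
  assumes "right_module R M" "right_module R N" "f \<in> rhom R M N"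
  shows "submodule R M (rkernel M N f)"
proof -
  interpret M: right_module R M by fact
  interpret N: right_module R N by fact
  show ?thesis
    using assms(3)
    by (auto simp: submodule_def rkernel_def rhom_zero[OF assms] rhom_neg[OF assms] rhom_add
        rhom_ract M.ract_closed)
qed

lemma rimage_submodule:
  assumes "right_module R M" "right_module R N" "f \<in> rhom R M N"
  shows "submodule R N (f ` carrier M)"
proof -
  interpret M: right_module R M by fact
  interpret N: right_module R N by fact
  show ?thesis
    using assms(3)
    by (auto simp: submodule_def rhom_zero[OF assms, symmetric] rhom_neg[OF assms, symmetric]
        rhom_add[symmetric] rhom_ract[symmetric] M.ract_closed rhom_closed)
qed

definition generated :: "'a ring \<Rightarrow> ('a, 'b) rmodule \<Rightarrow> 'b set \<Rightarrow> 'b set" where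
  "generated R M X = \<Inter>{S. submodule R M S \<and> X \<subseteq> S}"

lemma generated_submodule:
  assumes "right_module R M" "X \<subseteq> carrier M"
  shows "submodule R M (generated R M X)"
proof -
  interpret M: right_module R M by fact
  have "submodule R M (carrier M)"
    by (auto simp: submodule_def M.ract_closed)
  with assms(2) show ?thesis
    unfolding generated_def submodule_def by (auto 4 4)
qed

lemma generated_superset: "X \<subseteq> generated R M X"
  by (auto simp: generated_def)

lemma generated_least: "submodule R M S \<Longrightarrow> X \<subseteq> S \<Longrightarrow> generated R M X \<subseteq> S"
  by (auto simp: generated_def)

text \<open>
  The quotient by \<open>S\<close> is realised on a set of representatives of the cosets, hence on the same
  type and on a carrier that is no larger.
\<close>

lemma quotient_exists:
  assumes "right_module R M" "submodule R M S"
  obtains Q q where "right_module R Q" "carrier Q \<subseteq> carrier M" "q \<in> repi R M Q" "rkernel M Q q = S"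
proof -
  interpret M: right_module R M by fact
  have S: "x \<in> carrier M" if "x \<in> S" for x
    using that assms(2) by (auto simp: submodule_def)
  have S0: "\<zero>\<^bsub>M\<^esub> \<in> S" and Sadd: "\<And>x y. x \<in> S \<Longrightarrow> y \<in> S \<Longrightarrow> x \<oplus>\<^bsub>M\<^esub> y \<in> S"
    and Sneg: "\<And>x. x \<in> S \<Longrightarrow> \<ominus>\<^bsub>M\<^esub> x \<in> S" and Sact: "\<And>x a. x \<in> S \<Longrightarrow> a \<in> carrier R \<Longrightarrow> x \<odot>\<^bsub>M\<^esub> a \<in> S"
    using assms(2) by (auto simp: submodule_def)
  define r where "r x = (SOME y. y \<in> carrier M \<and> y \<ominus>\<^bsub>M\<^esub> x \<in> S)" for x
  have r: "r x \<in> carrier M" "r x \<ominus>\<^bsub>M\<^esub> x \<in> S" if "x \<in> carrier M" for x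
    using someI[of "\<lambda>y. y \<in> carrier M \<and> y \<ominus>\<^bsub>M\<^esub> x \<in> S" x] that S0
    unfolding r_def by (auto simp: M.M.r_neg a_minus_def)
  have trans: "x \<ominus>\<^bsub>M\<^esub> z \<in> S" if "x \<ominus>\<^bsub>M\<^esub> y \<in> S" "y \<ominus>\<^bsub>M\<^esub> z \<in> S"
    "x \<in> carrier M" "y \<in> carrier M" "z \<in> carrier M" for x y z
  proof -
    have "x \<ominus>\<^bsub>M\<^esub> z = (x \<ominus>\<^bsub>M\<^esub> y) \<oplus>\<^bsub>M\<^esub> (y \<ominus>\<^bsub>M\<^esub> z)"
      using that(3-) by (simp add: a_minus_def M.M.a_assoc M.M.r_neg1 M.M.r_neg2)
    then show ?thesis using Sadd[OF that(1,2)] by simp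
  qed
  have sym: "y \<ominus>\<^bsub>M\<^esub> x \<in> S" if "x \<ominus>\<^bsub>M\<^esub> y \<in> S" "x \<in> carrier M" "y \<in> carrier M" for x y
    using Sneg[OF that(1)] that(2,3) by (simp add: a_minus_def M.M.minus_add M.M.a_comm)
  have r_eq: "r x = r y \<longleftrightarrow> x \<ominus>\<^bsub>M\<^esub> y \<in> S" if "x \<in> carrier M" "y \<in> carrier M" for x y
  proof
    assume "r x = r y"
    then show "x \<ominus>\<^bsub>M\<^esub> y \<in> S"
      using r[OF that(1)] r[OF that(2)] trans sym that by metis
  next
    assume "x \<ominus>\<^bsub>M\<^esub> y \<in> S"
    then have "z \<ominus>\<^bsub>M\<^esub> x \<in> S \<longleftrightarrow> z \<ominus>\<^bsub>M\<^esub> y \<in> S" if "z \<in> carrier M" for z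
      using trans sym that \<open>x \<in> carrier M\<close> \<open>y \<in> carrier M\<close> by metis
    then have "(\<lambda>z. z \<in> carrier M \<and> z \<ominus>\<^bsub>M\<^esub> x \<in> S) = (\<lambda>z. z \<in> carrier M \<and> z \<ominus>\<^bsub>M\<^esub> y \<in> S)"
      by auto
    then show "r x = r y" by (simp add: r_def)
  qed
  let ?Q = "image_module r M"
  have cong_add: "r (x \<oplus>\<^bsub>M\<^esub> y) = r (x' \<oplus>\<^bsub>M\<^esub> y')"
    if "x \<in> carrier M" "x' \<in> carrier M" "y \<in> carrier M" "y' \<in> carrier M" "r x = r x'" "r y = r y'"
    for x x' y y'
  proof -
    have "(x \<oplus>\<^bsub>M\<^esub> y) \<ominus>\<^bsub>M\<^esub> (x' \<oplus>\<^bsub>M\<^esub> y') = (x \<ominus>\<^bsub>M\<^esub> x') \<oplus>\<^bsub>M\<^esub> (y \<ominus>\<^bsub>M\<^esub> y')"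
      using that(1-4) by (simp add: a_minus_def M.M.a_ac M.M.minus_add)
    then show ?thesis using that by (simp add: r_eq Sadd)
  qed
  have cong_act: "r (x \<odot>\<^bsub>M\<^esub> a) = r (x' \<odot>\<^bsub>M\<^esub> a)"
    if "x \<in> carrier M" "x' \<in> carrier M" "a \<in> carrier R" "r x = r x'" for x x' a
  proof -
    have "(x \<odot>\<^bsub>M\<^esub> a) \<ominus>\<^bsub>M\<^esub> (x' \<odot>\<^bsub>M\<^esub> a) = (x \<ominus>\<^bsub>M\<^esub> x') \<odot>\<^bsub>M\<^esub> a"
      using that(1-3) by (simp add: a_minus_def M.add_ract M.neg_ract)
    then show ?thesis using that by (simp add: r_eq Sact M.ract_closed)
  qed
  have Q: "right_module R ?Q" "r \<in> repi R M ?Q"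
    using image_module[OF assms(1), of r] cong_add cong_act by blast+
  moreover have "carrier ?Q \<subseteq> carrier M"
    using r by (auto simp: image_module_def)
  moreover have "rkernel M ?Q r = S"
  proof -
    have "r x = r \<zero>\<^bsub>M\<^esub> \<longleftrightarrow> x \<in> S" if "x \<in> carrier M" for x
      using that by (simp add: r_eq a_minus_def M.minus_zero)
    then show ?thesis using S by (auto simp: rkernel_def image_module_def)
  qed
  ultimately show ?thesis using that by blast
qed

section \<open>Direct sums\<close>

lemma direct_sum2_right_module:
  assumes "right_module R M" "right_module R N"
  shows "right_module R (direct_sum2 M N)"
proof -
  interpret M: right_module R M by fact
  interpret N: right_module R N by fact
  show ?thesis
  proof (rule right_moduleI)
    show "\<exists>y\<in>carrier (direct_sum2 M N). y \<oplus>\<^bsub>direct_sum2 M N\<^esub> x = \<zero>\<^bsub>direct_sum2 M N\<^esub>"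
      if "x \<in> carrier (direct_sum2 M N)" for x
      using that
      by (intro bexI[of _ "(\<ominus>\<^bsub>M\<^esub> fst x, \<ominus>\<^bsub>N\<^esub> snd x)"])
        (auto simp: direct_sum2_def M.M.l_neg N.M.l_neg)
  qed (auto simp: direct_sum2_def M.R.ring_axioms M.M.a_ac N.M.a_ac M.ract_closed N.ract_closed
      M.ract_add N.ract_add M.add_ract N.add_ract M.ract_mult N.ract_mult M.ract_one N.ract_one)
qed

lemma carrier_direct_sum2: "carrier (direct_sum2 M N) = carrier M \<times> carrier N"
  by (simp add: direct_sum2_def)

lemma direct_sum2_rhoms:
  assumes "right_module R M" "right_module R N"
  shows "fst \<in> rhom R (direct_sum2 M N) M" "snd \<in> rhom R (direct_sum2 M N) N"
    "(\<lambda>x. (x, \<zero>\<^bsub>N\<^esub>)) \<in> rhom R M (direct_sum2 M N)"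
    "(\<lambda>y. (\<zero>\<^bsub>M\<^esub>, y)) \<in> rhom R N (direct_sum2 M N)"
proof -
  interpret M: right_module R M by fact
  interpret N: right_module R N by fact
  show "fst \<in> rhom R (direct_sum2 M N) M" "snd \<in> rhom R (direct_sum2 M N) N"
    "(\<lambda>x. (x, \<zero>\<^bsub>N\<^esub>)) \<in> rhom R M (direct_sum2 M N)"
    "(\<lambda>y. (\<zero>\<^bsub>M\<^esub>, y)) \<in> rhom R N (direct_sum2 M N)"
    by (auto simp: rhom_def direct_sum2_def)
qed

lemma direct_sum_simps:
  "x \<in> carrier (direct_sum I F) \<longleftrightarrow>
     x \<in> (\<Pi>\<^sub>E i\<in>I. carrier (F i)) \<and> finite {i \<in> I. x i \<noteq> \<zero>\<^bsub>F i\<^esub>}"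
  "\<zero>\<^bsub>direct_sum I F\<^esub> = (\<lambda>i\<in>I. \<zero>\<^bsub>F i\<^esub>)"
  "x \<oplus>\<^bsub>direct_sum I F\<^esub> y = (\<lambda>i\<in>I. x i \<oplus>\<^bsub>F i\<^esub> y i)"
  "x \<odot>\<^bsub>direct_sum I F\<^esub> a = (\<lambda>i\<in>I. x i \<odot>\<^bsub>F i\<^esub> a)"
  by (auto simp: direct_sum_def)

lemma direct_sum_right_module:
  assumes "ring R" and F: "\<And>i. i \<in> I \<Longrightarrow> right_module R (F i)"
  shows "right_module R (direct_sum I F)"
proof -
  have ag: "abelian_group (F i)" if "i \<in> I" for i
    using F[OF that] by (simp add: right_module_def)
  note am = abelian_group.axioms(1)[OF ag]
  note [simp] = abelian_monoid.a_closed[OF am] abelian_monoid.zero_closed[OF am]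
    abelian_monoid.l_zero[OF am] abelian_group.a_inv_closed[OF ag] abelian_group.l_neg[OF ag]
    right_module.ract_closed[OF F] right_module.ract_one[OF F] right_module.zero_ract[OF F]
    right_module.minus_zero[OF F]
  note rules = abelian_monoid.a_assoc[OF am] right_module.ract_add[OF F] right_module.add_ract[OF F]
    right_module.ract_mult[OF F]
  have mem: "x i \<in> carrier (F i)" if "x \<in> carrier (direct_sum I F)" "i \<in> I" for x i
    using that by (auto simp: direct_sum_simps)
  show ?thesis
  proof (rule right_moduleI)
    show "x \<oplus>\<^bsub>direct_sum I F\<^esub> y \<in> carrier (direct_sum I F)"
      if "x \<in> carrier (direct_sum I F)" "y \<in> carrier (direct_sum I F)" for x y
    proof -
      have "finite ({i \<in> I. x i \<noteq> \<zero>\<^bsub>F i\<^esub>} \<union> {i \<in> I. y i \<noteq> \<zero>\<^bsub>F i\<^esub>})"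
        using that by (simp add: direct_sum_simps)
      then have "finite {i \<in> I. x i \<oplus>\<^bsub>F i\<^esub> y i \<noteq> \<zero>\<^bsub>F i\<^esub>}"
        by (rule rev_finite_subset) auto
      then show ?thesis
        using mem[OF that(1)] mem[OF that(2)] by (auto simp: direct_sum_simps cong: conj_cong)
    qed
    show "x \<odot>\<^bsub>direct_sum I F\<^esub> a \<in> carrier (direct_sum I F)"
      if "x \<in> carrier (direct_sum I F)" "a \<in> carrier R" for x a
    proof -
      have "finite {i \<in> I. x i \<noteq> \<zero>\<^bsub>F i\<^esub>}"
        using that by (simp add: direct_sum_simps)
      then have "finite {i \<in> I. x i \<odot>\<^bsub>F i\<^esub> a \<noteq> \<zero>\<^bsub>F i\<^esub>}"
        by (rule rev_finite_subset) (use that in auto)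
      then show ?thesis
        using mem[OF that(1)] that(2) by (auto simp: direct_sum_simps cong: conj_cong)
    qed
    show "\<exists>y\<in>carrier (direct_sum I F). y \<oplus>\<^bsub>direct_sum I F\<^esub> x = \<zero>\<^bsub>direct_sum I F\<^esub>"
      if "x \<in> carrier (direct_sum I F)" for x
    proof (rule bexI)
      let ?y = "\<lambda>i\<in>I. \<ominus>\<^bsub>F i\<^esub> x i"
      show "?y \<oplus>\<^bsub>direct_sum I F\<^esub> x = \<zero>\<^bsub>direct_sum I F\<^esub>"
        using mem[OF that] by (auto simp: direct_sum_simps)
      have "finite {i \<in> I. x i \<noteq> \<zero>\<^bsub>F i\<^esub>}"
        using that by (simp add: direct_sum_simps)
      then have "finite {i \<in> I. \<ominus>\<^bsub>F i\<^esub> x i \<noteq> \<zero>\<^bsub>F i\<^esub>}"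
        by (rule rev_finite_subset) auto
      then show "?y \<in> carrier (direct_sum I F)"
        using mem[OF that] by (auto simp: direct_sum_simps cong: conj_cong)
    qed
    show "x \<oplus>\<^bsub>direct_sum I F\<^esub> y = y \<oplus>\<^bsub>direct_sum I F\<^esub> x"
      if "x \<in> carrier (direct_sum I F)" "y \<in> carrier (direct_sum I F)" for x y
      using mem[OF that(1)] mem[OF that(2)]
      by (auto simp: direct_sum_simps fun_eq_iff abelian_monoid.a_comm[OF am])
    show "\<zero>\<^bsub>direct_sum I F\<^esub> \<oplus>\<^bsub>direct_sum I F\<^esub> x = x" if "x \<in> carrier (direct_sum I F)" for x
      using that by (auto simp: direct_sum_simps fun_eq_iff PiE_def extensional_def Pi_iff)
    show "x \<odot>\<^bsub>direct_sum I F\<^esub> \<one>\<^bsub>R\<^esub> = x" if "x \<in> carrier (direct_sum I F)" for x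
      using that by (auto simp: direct_sum_simps fun_eq_iff PiE_def extensional_def Pi_iff)
  qed (use mem assms(1) in \<open>auto simp: direct_sum_simps rules ring.ring_simprules(1,5) fun_eq_iff\<close>)
qed

definition injection :: "'i set \<Rightarrow> ('i \<Rightarrow> ('a, 'b) rmodule) \<Rightarrow> 'i \<Rightarrow> 'b \<Rightarrow> 'i \<Rightarrow> 'b" where
  "injection I F i t = (\<lambda>j\<in>I. if j = i then t else \<zero>\<^bsub>F j\<^esub>)"

lemma injection_rhom:
  assumes "\<And>i. i \<in> I \<Longrightarrow> right_module R (F i)" "i \<in> I"
  shows "injection I F i \<in> rhom R (F i) (direct_sum I F)"
proof -
  have am: "abelian_monoid (F j)" if "j \<in> I" for j
    using assms(1)[OF that] by (simp add: right_module_def abelian_group_def)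
  note [simp] = abelian_monoid.zero_closed[OF am] abelian_monoid.l_zero[OF am]
    right_module.zero_ract[OF assms(1)]
  have "injection I F i t \<in> carrier (direct_sum I F)" if "t \<in> carrier (F i)" for t
  proof -
    have "finite {j \<in> I. (if j = i then t else \<zero>\<^bsub>F j\<^esub>) \<noteq> \<zero>\<^bsub>F j\<^esub>}"
      by (rule finite_subset[of _ "{i}"]) auto
    with that show ?thesis
      by (auto simp: injection_def direct_sum_simps cong: conj_cong)
  qed
  then show ?thesis
    by (intro rhomI) (auto simp: injection_def direct_sum_simps fun_eq_iff)
qed

lemma direct_sum_induct:
  assumes F: "\<And>i. i \<in> I \<Longrightarrow> right_module R (F i)"
    and "\<zero>\<^bsub>direct_sum I F\<^esub> \<in> S"
    and "\<And>x y. x \<in> S \<Longrightarrow> y \<in> S \<Longrightarrow> x \<oplus>\<^bsub>direct_sum I F\<^esub> y \<in> S"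
    and "\<And>i t. i \<in> I \<Longrightarrow> t \<in> carrier (F i) \<Longrightarrow> injection I F i t \<in> S"
  shows "carrier (direct_sum I F) \<subseteq> S"
proof
  fix x assume "x \<in> carrier (direct_sum I F)"
  then have x: "x \<in> (\<Pi>\<^sub>E i\<in>I. carrier (F i))" and fin: "finite {i \<in> I. x i \<noteq> \<zero>\<^bsub>F i\<^esub>}"
    by (auto simp: direct_sum_simps)
  have am: "abelian_monoid (F j)" if "j \<in> I" for j
    using F[OF that] by (simp add: right_module_def abelian_group_def)
  have "\<forall>x \<in> (\<Pi>\<^sub>E i\<in>I. carrier (F i)). {i \<in> I. x i \<noteq> \<zero>\<^bsub>F i\<^esub>} \<subseteq> A \<longrightarrow> x \<in> S" if "finite A" for A
    using that
  proof (induction A)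
    case empty
    have "x = \<zero>\<^bsub>direct_sum I F\<^esub>" if "x \<in> (\<Pi>\<^sub>E i\<in>I. carrier (F i))" "{i \<in> I. x i \<noteq> \<zero>\<^bsub>F i\<^esub>} \<subseteq> {}" for x
      using that by (auto simp: direct_sum_simps fun_eq_iff PiE_def extensional_def)
    then show ?case using assms(2) by blast
  next
    case (insert k A)
    show ?case
    proof (intro ballI impI)
      fix x assume x: "x \<in> (\<Pi>\<^sub>E i\<in>I. carrier (F i))" "{i \<in> I. x i \<noteq> \<zero>\<^bsub>F i\<^esub>} \<subseteq> insert k A"
      show "x \<in> S"
      proof (cases "k \<in> I")
        case False
        then have "{i \<in> I. x i \<noteq> \<zero>\<^bsub>F i\<^esub>} \<subseteq> A" using x(2) by auto
        with x(1) insert.IH show ?thesis by blast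
      next
        case True
        let ?y = "x(k := \<zero>\<^bsub>F k\<^esub>)"
        have "?y \<in> S"
        proof -
          have "?y \<in> (\<Pi>\<^sub>E i\<in>I. carrier (F i))"
            using x(1) True abelian_monoid.zero_closed[OF am[OF True]]
            by (auto simp: PiE_def Pi_iff extensional_def)
          moreover have "{i \<in> I. ?y i \<noteq> \<zero>\<^bsub>F i\<^esub>} \<subseteq> A" using x(2) by auto
          ultimately show ?thesis using insert.IH by blast
        qed
        moreover have "injection I F k (x k) \<in> S"
          using assms(4) True x(1) by auto
        moreover have "x = injection I F k (x k) \<oplus>\<^bsub>direct_sum I F\<^esub> ?y"
        proof
          fix j
          show "x j = (injection I F k (x k) \<oplus>\<^bsub>direct_sum I F\<^esub> ?y) j"
          proof (cases "j \<in> I")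
            case True
            then show ?thesis
              using x(1) abelian_monoid.l_zero[OF am[OF True]] abelian_monoid.r_zero[OF am[OF True]]
              by (auto simp: direct_sum_simps injection_def PiE_def Pi_iff)
          qed (use x(1) in \<open>auto simp: direct_sum_simps PiE_def extensional_def\<close>)
        qed
        ultimately show ?thesis using assms(3) by metis
      qed
    qed
  qed
  from this[OF fin] x show "x \<in> S" by blast
qed

text \<open>
  The map is \<open>x \<mapsto> \<Sum>\<^sub>i f i (x i)\<close>, summed over the support of \<open>x\<close>. Enlarging the range of summation
  to a finite set containing several supports makes it additive.
\<close>

lemma direct_sum_universal:
  assumes F: "\<And>i. i \<in> I \<Longrightarrow> right_module R (F i)" and N: "right_module R N"
    and f: "\<And>i. i \<in> I \<Longrightarrow> f i \<in> rhom R (F i) N"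
  shows "\<exists>g\<in>rhom R (direct_sum I F) N. \<forall>i\<in>I. \<forall>t\<in>carrier (F i). g (injection I F i t) = f i t"
proof -
  interpret N: right_module R N by fact
  have ring: "ring R" by (rule N.R.ring_axioms)
  interpret D: right_module R "direct_sum I F"
    using direct_sum_right_module[of R I F, OF ring F] .
  define supp where "supp x = {i \<in> I. x i \<noteq> \<zero>\<^bsub>F i\<^esub>}" for x
  define g where "g x = (\<Oplus>\<^bsub>N\<^esub>i\<in>supp x. f i (x i))" for x
  have mem: "x i \<in> carrier (F i)" if "x \<in> carrier (direct_sum I F)" "i \<in> I" for x i
    using that by (auto simp: direct_sum_simps)
  have fin: "finite (supp x)" if "x \<in> carrier (direct_sum I F)" for x
    using that by (auto simp: direct_sum_simps supp_def)
  have fx: "f i (x i) \<in> carrier N" if "x \<in> carrier (direct_sum I F)" "i \<in> I" for x i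
    using rhom_closed[OF f[OF that(2)] mem[OF that]] .
  have g_eq: "g x = (\<Oplus>\<^bsub>N\<^esub>i\<in>A. f i (x i))"
    if "x \<in> carrier (direct_sum I F)" "finite A" "supp x \<subseteq> A" "A \<subseteq> I" for x A
    unfolding g_def
  proof (rule N.M.add.finprod_mono_neutral_cong_left[OF that(2,3)])
    show "f i (x i) = \<zero>\<^bsub>N\<^esub>" if "i \<in> A - supp x" for i
      using that \<open>A \<subseteq> I\<close> rhom_zero[OF F N f, of i] by (auto simp: supp_def)
  qed (use that fx in auto)
  have supp_sub: "supp x \<subseteq> I" for x
    by (auto simp: supp_def)
  show ?thesis
  proof (intro bexI ballI)
    show "g (injection I F i t) = f i t" if "i \<in> I" "t \<in> carrier (F i)" for i t
    proof -
      have inj: "injection I F i t \<in> carrier (direct_sum I F)"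
        using rhom_closed[OF injection_rhom[of I R F, OF F]] that by blast
      have "g (injection I F i t) = (\<Oplus>\<^bsub>N\<^esub>j\<in>{i}. f j (injection I F i t j))"
        by (rule g_eq[OF inj]) (use that in \<open>auto simp: supp_def injection_def split: if_splits\<close>)
      then show ?thesis
        using that rhom_closed[OF f] by (simp add: injection_def)
    qed
    show "g \<in> rhom R (direct_sum I F) N"
    proof (rule rhomI)
      show "g x \<in> carrier N" if "x \<in> carrier (direct_sum I F)" for x
        unfolding g_def using that fx supp_sub by (intro N.M.finsum_closed) blast
      show "g (x \<oplus>\<^bsub>direct_sum I F\<^esub> y) = g x \<oplus>\<^bsub>N\<^esub> g y"
        if "x \<in> carrier (direct_sum I F)" "y \<in> carrier (direct_sum I F)" for x y
      proof -
        let ?A = "supp x \<union> supp y \<union> supp (x \<oplus>\<^bsub>direct_sum I F\<^esub> y)"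
        have A: "finite ?A" "?A \<subseteq> I"
          using that fin supp_sub by auto
        have "g (x \<oplus>\<^bsub>direct_sum I F\<^esub> y) = (\<Oplus>\<^bsub>N\<^esub>i\<in>?A. f i ((x \<oplus>\<^bsub>direct_sum I F\<^esub> y) i))"
          by (rule g_eq) (use that A in auto)
        also have "\<dots> = (\<Oplus>\<^bsub>N\<^esub>i\<in>?A. f i (x i) \<oplus>\<^bsub>N\<^esub> f i (y i))"
        proof (rule N.M.finsum_cong')
          show "f i ((x \<oplus>\<^bsub>direct_sum I F\<^esub> y) i) = f i (x i) \<oplus>\<^bsub>N\<^esub> f i (y i)" if "i \<in> ?A" for i
          proof -
            have i: "i \<in> I" using that A by blast
            show ?thesis
              using rhom_add[OF f[OF i] mem[OF \<open>x \<in> _\<close> i] mem[OF \<open>y \<in> _\<close> i]] i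
              by (simp add: direct_sum_simps)
          qed
        qed (use A fx that in \<open>auto intro!: N.M.a_closed\<close>)
        also have "\<dots> = (\<Oplus>\<^bsub>N\<^esub>i\<in>?A. f i (x i)) \<oplus>\<^bsub>N\<^esub> (\<Oplus>\<^bsub>N\<^esub>i\<in>?A. f i (y i))"
          by (rule N.M.finsum_addf) (use A fx that in auto)
        also have "(\<Oplus>\<^bsub>N\<^esub>i\<in>?A. f i (x i)) = g x"
          by (rule g_eq[symmetric]) (use that A in auto)
        also have "(\<Oplus>\<^bsub>N\<^esub>i\<in>?A. f i (y i)) = g y"
          by (rule g_eq[symmetric]) (use that A in auto)
        finally show ?thesis .
      qed
      show "g (x \<odot>\<^bsub>direct_sum I F\<^esub> a) = g x \<odot>\<^bsub>N\<^esub> a"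
        if "x \<in> carrier (direct_sum I F)" "a \<in> carrier R" for x a
      proof -
        let ?A = "supp x \<union> supp (x \<odot>\<^bsub>direct_sum I F\<^esub> a)"
        have A: "finite ?A" "?A \<subseteq> I"
          using that fin supp_sub D.ract_closed by auto
        have act: "(\<lambda>u. u \<odot>\<^bsub>N\<^esub> a) (\<Oplus>\<^bsub>N\<^esub>i\<in>B. u i) = (\<Oplus>\<^bsub>N\<^esub>i\<in>B. u i \<odot>\<^bsub>N\<^esub> a)"
          if "finite B" "\<And>i. i \<in> B \<Longrightarrow> u i \<in> carrier N" for B u
          using that
          by (induction B) (auto simp: N.add_ract N.ract_closed \<open>a \<in> carrier R\<close> Pi_iff)
        have "g (x \<odot>\<^bsub>direct_sum I F\<^esub> a) = (\<Oplus>\<^bsub>N\<^esub>i\<in>?A. f i ((x \<odot>\<^bsub>direct_sum I F\<^esub> a) i))"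
          by (rule g_eq) (use that A D.ract_closed in auto)
        also have "\<dots> = (\<Oplus>\<^bsub>N\<^esub>i\<in>?A. f i (x i) \<odot>\<^bsub>N\<^esub> a)"
        proof (rule N.M.finsum_cong')
          show "f i ((x \<odot>\<^bsub>direct_sum I F\<^esub> a) i) = f i (x i) \<odot>\<^bsub>N\<^esub> a" if "i \<in> ?A" for i
          proof -
            have i: "i \<in> I" using that A by blast
            show ?thesis
              using rhom_ract[OF f[OF i] mem[OF \<open>x \<in> _\<close> i] \<open>a \<in> _\<close>] i
              by (simp add: direct_sum_simps)
          qed
        qed (use A fx that in \<open>auto intro!: N.ract_closed\<close>)
        also have "\<dots> = (\<Oplus>\<^bsub>N\<^esub>i\<in>?A. f i (x i)) \<odot>\<^bsub>N\<^esub> a"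
          using act[of ?A "\<lambda>i. f i (x i)"] A fx that by (metis subsetD)
        also have "(\<Oplus>\<^bsub>N\<^esub>i\<in>?A. f i (x i)) = g x"
          by (rule g_eq[symmetric]) (use that A in auto)
        finally show ?thesis .
      qed
    qed
  qed
qed

section \<open>Smallness\<close>

text \<open>
  Smallness relative to \<open>'u\<close> for sets of any type: sums, pullbacks and submodules are first built on
  types other than \<open>'u\<close>.
\<close>

definition small_in :: "'u itself \<Rightarrow> 'x set \<Rightarrow> bool" where
  "small_in U X \<longleftrightarrow> |X| <o |UNIV :: 'u set|"

locale module_category =
  fixes R :: "'a ring" and U :: "'u itself"
  assumes ring: "ring R" and module_universe: "module_universe R U"
begin

abbreviation usmall :: "'x set \<Rightarrow> bool" where
  "usmall \<equiv> small_in U"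

lemma infinite_universe: "infinite (UNIV :: 'u set)"
proof -
  have "|UNIV :: nat set| \<le>o |UNIV :: 'u set|"
    using module_universe card_of_nat ordIso_ordLess_trans ordLess_imp_ordLeq
    unfolding module_universe_def by blast
  then show ?thesis
    using card_of_ordLeq_infinite infinite_UNIV_nat by blast
qed

lemma usmall_subset: "usmall Y \<Longrightarrow> X \<subseteq> Y \<Longrightarrow> usmall X"
  unfolding small_in_def using ordLeq_ordLess_trans card_of_mono1 by blast

lemma usmall_image: "usmall X \<Longrightarrow> usmall (f ` X)"
  unfolding small_in_def using ordLeq_ordLess_trans card_of_image by blast

lemma usmall_finite: "finite X \<Longrightarrow> usmall X"
  unfolding small_in_def using infinite_universe
  by (intro finite_ordLess_infinite[OF card_of_Well_order card_of_Well_order])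
    (simp_all add: Field_card_of)

lemma usmall_UN: "usmall I \<Longrightarrow> (\<And>i. i \<in> I \<Longrightarrow> usmall (X i)) \<Longrightarrow> usmall (\<Union>i\<in>I. X i)"
  using module_universe infinite_universe unfolding module_universe_def small_in_def
  by (intro card_of_UNION_ordLess_infinite_Field_regularCard) (auto simp: cinfinite_def Field_card_of card_of_card_order_on)

lemma usmall_Times: "usmall X \<Longrightarrow> usmall Y \<Longrightarrow> usmall (X \<times> Y)"
proof -
  assume "usmall X" "usmall Y"
  then have "usmall (\<Union>x\<in>X. Pair x ` Y)"
    by (intro usmall_UN usmall_image)
  then show ?thesis by (rule usmall_subset) auto
qed

lemma usmall_Sigma: "usmall I \<Longrightarrow> (\<And>i. i \<in> I \<Longrightarrow> usmall (X i)) \<Longrightarrow> usmall (SIGMA i:I. X i)"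
  unfolding Sigma_def by (intro usmall_UN) (auto intro: usmall_finite)

lemma usmall_Un: "usmall X \<Longrightarrow> usmall Y \<Longrightarrow> usmall (X \<union> Y)"
  unfolding small_in_def using infinite_universe by (rule card_of_Un_ordLess_infinite)

lemma usmall_nat: "usmall (UNIV :: nat set)"
  using module_universe unfolding module_universe_def small_in_def
  by (meson card_of_nat ordIso_ordLess_trans)

text \<open>
  The cardinal of the universe is regular and uncountable, so that a countable union of small sets
  is small.
\<close>

lemma usmall_lists: "usmall X \<Longrightarrow> usmall {xs. set xs \<subseteq> X}"
proof -
  assume X: "usmall X"
  have "usmall {xs. set xs \<subseteq> X \<and> length xs = n}" for n
  proof (induction n)
    case (Suc n)
    have "usmall ((\<lambda>(x, xs). x # xs) ` (X \<times> {xs. set xs \<subseteq> X \<and> length xs = n}))"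
      by (intro usmall_image usmall_Times X Suc)
    then show ?case
      by (rule usmall_subset) (auto simp: image_iff length_Suc_conv)
  qed (auto intro: usmall_finite)
  then have "usmall (\<Union>n. {xs. set xs \<subseteq> X \<and> length xs = n})"
    by (intro usmall_UN usmall_nat)
  then show ?thesis by (rule usmall_subset) auto
qed

text \<open>
  A family of finite support is encoded by the list of its nonzero entries together with their
  indices.
\<close>

lemma usmall_direct_sum:
  assumes "usmall I" "\<And>i. i \<in> I \<Longrightarrow> usmall (carrier (F i))"
  shows "usmall (carrier (direct_sum I F))"
proof -
  let ?f = "\<lambda>xs. \<lambda>i\<in>I. case map_of xs i of None \<Rightarrow> \<zero>\<^bsub>F i\<^esub> | Some t \<Rightarrow> t"
  have "carrier (direct_sum I F) \<subseteq> ?f ` {xs. set xs \<subseteq> (SIGMA i:I. carrier (F i))}"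
  proof
    fix x assume x: "x \<in> carrier (direct_sum I F)"
    then have "finite {i \<in> I. x i \<noteq> \<zero>\<^bsub>F i\<^esub>}"
      by (auto simp: direct_sum_simps)
    then obtain ks where ks: "set ks = {i \<in> I. x i \<noteq> \<zero>\<^bsub>F i\<^esub>}"
      using finite_list by blast
    let ?xs = "map (\<lambda>i. (i, x i)) ks"
    have "x = ?f ?xs"
      using x by (auto simp: direct_sum_simps fun_eq_iff PiE_def extensional_def map_of_map_restrict
          restrict_map_def ks)
    moreover have "set ?xs \<subseteq> (SIGMA i:I. carrier (F i))"
      using x by (auto simp: ks direct_sum_simps)
    ultimately show "x \<in> ?f ` {xs. set xs \<subseteq> (SIGMA i:I. carrier (F i))}"
      by blast
  qed
  moreover have "usmall (?f ` {xs. set xs \<subseteq> (SIGMA i:I. carrier (F i))})"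
    by (intro usmall_image usmall_lists usmall_Sigma assms)
  ultimately show ?thesis by (rule usmall_subset[rotated])
qed

abbreviation MOD :: "('a, 'u) rmodule set" where
  "MOD \<equiv> Mod R"

lemma Mod_iff: "(M :: ('a, 'u) rmodule) \<in> Mod R \<longleftrightarrow> right_module R M \<and> usmall (carrier M)"
  by (simp add: Mod_def small_def small_in_def)

lemma ModD: "(M :: ('a, 'u) rmodule) \<in> Mod R \<Longrightarrow> right_module R M"
  "(M :: ('a, 'u) rmodule) \<in> Mod R \<Longrightarrow> usmall (carrier M)"
  by (simp_all add: Mod_iff)

text \<open>
  The way back into the universe: a construction with a small carrier is isomorphic to a module in
  the category.
\<close>

lemma small_copy:
  assumes "right_module R M" "usmall (carrier M)"
  obtains N :: "('a, 'u) rmodule" and r where "N \<in> Mod R" "r \<in> riso R M N"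
proof -
  obtain r :: "_ \<Rightarrow> 'u" where r: "inj_on r (carrier M)"
    using ordLess_imp_ordLeq[OF assms(2)[unfolded small_in_def]]
      card_of_ordLeq[of "carrier M" "UNIV :: 'u set"] by auto
  have eq: "r x = r y \<Longrightarrow> x = y" if "x \<in> carrier M" "y \<in> carrier M" for x y
    using r that by (auto dest: inj_onD)
  have "right_module R (image_module r M)" "r \<in> repi R M (image_module r M)"
    using image_module[OF assms(1), of r] eq by blast+
  moreover have "usmall (carrier (image_module r M))"
    using usmall_image[OF assms(2), of r] by (simp add: image_module_def)
  ultimately show ?thesis
    using r by (intro that[of "image_module r M" r]) (auto simp: Mod_iff repi_def riso_def bij_betw_def)
qed

end

text \<open>
  A direct sum only up to isomorphism, so that one can work with copies whose carrier lies in the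
  universe. Besides the isomorphism with the concrete direct sum only the universal property and
  generation by the images of the summands are recorded. The universal property refers to modules on
  the type of \<open>P\<close>, as a formula cannot quantify over types.
\<close>

definition coproduct ::
  "'a ring \<Rightarrow> 'i set \<Rightarrow> ('i \<Rightarrow> ('a, 'b) rmodule) \<Rightarrow> ('a, 'c) rmodule \<Rightarrow> ('i \<Rightarrow> 'b \<Rightarrow> 'c) \<Rightarrow> bool" where
  "coproduct R I F P \<iota> \<longleftrightarrow>
     riso R (direct_sum I F) P \<noteq> {} \<and>
     (\<forall>i\<in>I. \<iota> i \<in> rhom R (F i) P) \<and>
     (\<forall>S. \<zero>\<^bsub>P\<^esub> \<in> S \<longrightarrow> (\<forall>x\<in>S. \<forall>y\<in>S. x \<oplus>\<^bsub>P\<^esub> y \<in> S) \<longrightarrow>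
        (\<forall>i\<in>I. \<forall>t\<in>carrier (F i). \<iota> i t \<in> S) \<longrightarrow> carrier P \<subseteq> S) \<and>
     (\<forall>(N :: ('a, 'c) rmodule) f. right_module R N \<longrightarrow> (\<forall>i\<in>I. f i \<in> rhom R (F i) N) \<longrightarrow>
        (\<exists>g\<in>rhom R P N. \<forall>i\<in>I. \<forall>t\<in>carrier (F i). g (\<iota> i t) = f i t))"

lemma coproduct_iso: "coproduct R I F P \<iota> \<Longrightarrow> riso R (direct_sum I F) P \<noteq> {}"
  by (simp add: coproduct_def)

lemma coproduct_injection: "coproduct R I F P \<iota> \<Longrightarrow> i \<in> I \<Longrightarrow> \<iota> i \<in> rhom R (F i) P"
  by (simp add: coproduct_def)

lemma coproduct_induct:
  assumes "coproduct R I F P \<iota>" "x \<in> carrier P" "Q \<zero>\<^bsub>P\<^esub>"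
    and "\<And>x y. x \<in> carrier P \<Longrightarrow> y \<in> carrier P \<Longrightarrow> Q x \<Longrightarrow> Q y \<Longrightarrow> Q (x \<oplus>\<^bsub>P\<^esub> y)"
    and "\<And>i t. i \<in> I \<Longrightarrow> t \<in> carrier (F i) \<Longrightarrow> Q (\<iota> i t)"
    and "right_module R P"
  shows "Q x"
proof -
  interpret P: right_module R P by fact
  have \<iota>: "\<iota> i t \<in> carrier P" if "i \<in> I" "t \<in> carrier (F i)" for i t
    using rhom_closed[OF coproduct_injection[OF assms(1) that(1)] that(2)] .
  have "carrier P \<subseteq> {x \<in> carrier P. Q x}"
    by (rule assms(1)[unfolded coproduct_def, THEN conjunct2, THEN conjunct2, THEN conjunct1, rule_format])
      (simp_all add: assms(3-5) \<iota>)
  then show ?thesis using assms(2) by blast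
qed

lemma coproduct_universal:
  fixes P :: "('a, 'c) rmodule" and N :: "('a, 'c) rmodule"
  assumes "coproduct R I F P \<iota>" "right_module R N" "\<And>i. i \<in> I \<Longrightarrow> f i \<in> rhom R (F i) N"
  shows "\<exists>g\<in>rhom R P N. \<forall>i\<in>I. \<forall>t\<in>carrier (F i). g (\<iota> i t) = f i t"
  by (rule assms(1)[unfolded coproduct_def, THEN conjunct2, THEN conjunct2, THEN conjunct2,
        THEN spec, THEN spec, THEN mp, THEN mp]) (use assms(2,3) in blast)+

lemma (in module_category) coproduct_exists:
  fixes F :: "'u \<Rightarrow> ('a, 'u) rmodule"
  assumes "usmall I" and F: "\<And>i. i \<in> I \<Longrightarrow> F i \<in> Mod R"
  obtains P :: "('a, 'u) rmodule" and \<iota> where "P \<in> Mod R" "coproduct R I F P \<iota>"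
proof -
  have mod: "right_module R (F i)" if "i \<in> I" for i
    using F that by (simp add: Mod_iff)
  have D: "right_module R (direct_sum I F)"
    using direct_sum_right_module[of R I F] ring mod by blast
  have "usmall (carrier (direct_sum I F))"
    by (rule usmall_direct_sum[OF assms(1) ModD(2)[OF F]])
  then obtain P :: "('a, 'u) rmodule" and r where P: "P \<in> Mod R" and r: "r \<in> riso R (direct_sum I F) P"
    using small_copy[OF D] by blast
  have rr: "r \<in> rhom R (direct_sum I F) P" and rc: "r ` carrier (direct_sum I F) = carrier P"
    using r by (auto simp: riso_def bij_betw_def)
  have Pm: "right_module R P"
    using P by (simp add: Mod_iff)
  interpret D: right_module R "direct_sum I F" by fact
  let ?\<iota> = "\<lambda>i t. r (injection I F i t)"
  let ?s = "inv_into (carrier (direct_sum I F)) r"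
  have s: "?s \<in> riso R P (direct_sum I F)"
    by (rule riso_inv[OF D r])
  have sr: "?s (r x) = x" if "x \<in> carrier (direct_sum I F)" for x
    using r that by (auto simp: riso_def bij_betw_def)
  have inj: "injection I F i t \<in> carrier (direct_sum I F)" if "i \<in> I" "t \<in> carrier (F i)" for i t
    using rhom_closed[OF injection_rhom[of I R F, OF mod]] that by blast
  have "coproduct R I F P ?\<iota>"
    unfolding coproduct_def
  proof (intro conjI allI impI ballI)
    show "riso R (direct_sum I F) P \<noteq> {}" using r by blast
    show "?\<iota> i \<in> rhom R (F i) P" if "i \<in> I" for i
      by (rule rhom_comp[OF injection_rhom rr]) (use mod that in auto)
    show "carrier P \<subseteq> S" if S: "\<zero>\<^bsub>P\<^esub> \<in> S" "\<forall>x\<in>S. \<forall>y\<in>S. x \<oplus>\<^bsub>P\<^esub> y \<in> S"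
      "\<forall>i\<in>I. \<forall>t\<in>carrier (F i). ?\<iota> i t \<in> S" for S
    proof -
      have "carrier (direct_sum I F) \<subseteq> {x \<in> carrier (direct_sum I F). r x \<in> S}"
        using S inj mod
        by (intro direct_sum_induct[where R = R])
          (auto simp: rhom_zero[OF D Pm rr] rhom_add[OF rr])
      then show ?thesis unfolding rc[symmetric] by blast
    qed
    show "\<exists>g\<in>rhom R P N. \<forall>i\<in>I. \<forall>t\<in>carrier (F i). g (?\<iota> i t) = f i t"
      if N: "right_module R N" and f: "\<forall>i\<in>I. f i \<in> rhom R (F i) N" for N :: "('a, 'u) rmodule" and f
    proof -
      obtain g where g: "g \<in> rhom R (direct_sum I F) N"
        "\<forall>i\<in>I. \<forall>t\<in>carrier (F i). g (injection I F i t) = f i t"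
        using direct_sum_universal[of I R F N f, OF mod N f[rule_format]] by auto
      have "?s \<in> rhom R P (direct_sum I F)"
        using s by (simp add: riso_def)
      then have gs: "(\<lambda>x. g (?s x)) \<in> rhom R P N"
        by (rule rhom_comp[OF _ g(1)])
      have gi: "g (?s (?\<iota> i t)) = f i t" if "i \<in> I" "t \<in> carrier (F i)" for i t
        using g(2) sr[OF inj[OF that]] that by simp
      show ?thesis
      proof (intro bexI ballI)
        show "g (?s (?\<iota> i t)) = f i t" if "i \<in> I" "t \<in> carrier (F i)" for i t
          by (rule gi[OF that])
      qed (rule gs)
    qed
  qed
  with P show ?thesis using that by blast
qed

section \<open>Ext-projective modules\<close>

lemma factor_through_mono:
  assumes "right_module R L" "right_module R P"
    and i: "i \<in> rhom R P M" "inj_on i (carrier P)"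
    and f: "f \<in> rhom R L M" "f ` carrier L \<subseteq> i ` carrier P"
  shows "\<exists>g\<in>rhom R L P. \<forall>x\<in>carrier L. i (g x) = f x"
proof -
  interpret L: right_module R L by fact
  interpret P: right_module R P by fact
  let ?g = "\<lambda>x. inv_into (carrier P) i (f x)"
  have g: "?g x \<in> carrier P" "i (?g x) = f x" if "x \<in> carrier L" for x
  proof -
    have "f x \<in> i ` carrier P" using f(2) that by blast
    then show "?g x \<in> carrier P" "i (?g x) = f x"
      by (rule inv_into_into, rule f_inv_into_f)
  qed
  have eq: "?g x = y" if "x \<in> carrier L" "y \<in> carrier P" "i y = f x" for x y
    using inj_onD[OF i(2)] g that by metis
  have "?g \<in> rhom R L P"
  proof (rule rhomI)
    show "?g (x \<oplus>\<^bsub>L\<^esub> y) = ?g x \<oplus>\<^bsub>P\<^esub> ?g y" if "x \<in> carrier L" "y \<in> carrier L" for x y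
      by (rule eq) (simp_all add: that g rhom_add[OF i(1)] rhom_add[OF f(1)])
    show "?g (x \<odot>\<^bsub>L\<^esub> a) = ?g x \<odot>\<^bsub>P\<^esub> a" if "x \<in> carrier L" "a \<in> carrier R" for x a
      by (rule eq) (simp_all add: that g L.ract_closed P.ract_closed rhom_ract[OF i(1)] rhom_ract[OF f(1)])
  qed (rule g)
  then show ?thesis using g(2) by (intro bexI[of _ ?g] ballI)
qed

lemma short_exactD:
  assumes "short_exact R N f E g M"
  shows "f \<in> rhom R N E" "g \<in> rhom R E M" "g ` carrier E = carrier M" "inj_on f (carrier N)"
    "\<And>x. x \<in> carrier N \<Longrightarrow> g (f x) = \<zero>\<^bsub>M\<^esub>"
    "\<And>y. y \<in> carrier E \<Longrightarrow> g y = \<zero>\<^bsub>M\<^esub> \<Longrightarrow> \<exists>x\<in>carrier N. y = f x"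
  using assms by (auto simp: short_exact_def right_exact_def repi_def rkernel_def)

text \<open>
  A section \<open>s\<close> of \<open>g\<close> gives the isomorphism \<open>(n, m) \<mapsto> f n + s m\<close> from the trivial extension;
  conversely the inverse of an isomorphism restricts to a section on the second summand.
\<close>

lemma ext_equiv_trivial_iff:
  assumes N: "right_module R N" and E: "right_module R E" and M: "right_module R M"
    and ex: "short_exact R N f E g M"
  shows "ext_equiv R N (E, f, g) (direct_sum2 N M, (\<lambda>x. (x, \<zero>\<^bsub>M\<^esub>)), snd) \<longleftrightarrow>
    (\<exists>s\<in>rhom R M E. \<forall>x\<in>carrier M. g (s x) = x)"
proof
  interpret N: right_module R N by fact
  interpret M: right_module R M by fact
  interpret E: right_module R E by fact
  note ex = short_exactD[OF ex]
  note D = direct_sum2_right_module[OF N M]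
  show "\<exists>s\<in>rhom R M E. \<forall>x\<in>carrier M. g (s x) = x"
    if "ext_equiv R N (E, f, g) (direct_sum2 N M, (\<lambda>x. (x, \<zero>\<^bsub>M\<^esub>)), snd)"
  proof -
    obtain h where h: "h \<in> riso R E (direct_sum2 N M)" "\<forall>y\<in>carrier E. snd (h y) = g y"
      using \<open>ext_equiv _ _ _ _\<close> by (auto simp: ext_equiv_def)
    let ?k = "inv_into (carrier E) h"
    have k: "?k \<in> rhom R (direct_sum2 N M) E"
      using riso_inv[OF E h(1)] by (simp add: riso_def)
    have hk: "h (?k z) = z" if "z \<in> carrier (direct_sum2 N M)" for z
      using h(1) that by (auto simp: riso_def bij_betw_def intro: f_inv_into_f)
    show ?thesis
    proof (intro bexI ballI)
      show "(\<lambda>x. ?k (\<zero>\<^bsub>N\<^esub>, x)) \<in> rhom R M E"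
        by (rule rhom_comp[OF direct_sum2_rhoms(4)[OF N M] k])
      show "g (?k (\<zero>\<^bsub>N\<^esub>, x)) = x" if "x \<in> carrier M" for x
      proof -
        have z: "(\<zero>\<^bsub>N\<^esub>, x) \<in> carrier (direct_sum2 N M)"
          using that by (simp add: carrier_direct_sum2)
        then show ?thesis
          using h(2) hk rhom_closed[OF k] by (metis snd_conv)
      qed
    qed
  qed
  show "ext_equiv R N (E, f, g) (direct_sum2 N M, (\<lambda>x. (x, \<zero>\<^bsub>M\<^esub>)), snd)"
    if split: "\<exists>s\<in>rhom R M E. \<forall>x\<in>carrier M. g (s x) = x"
  proof -
    obtain s where s: "s \<in> rhom R M E" and gs: "\<And>x. x \<in> carrier M \<Longrightarrow> g (s x) = x"
      using split by auto
    note cl = rhom_closed[OF s] rhom_closed[OF ex(1)] rhom_closed[OF ex(2)]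
    let ?k = "\<lambda>z. f (fst z) \<oplus>\<^bsub>E\<^esub> s (snd z)"
    have k: "?k \<in> rhom R (direct_sum2 N M) E"
      by (intro rhom_plus E rhom_comp[OF direct_sum2_rhoms(1)[OF N M] ex(1)]
          rhom_comp[OF direct_sum2_rhoms(2)[OF N M] s])
    have gk: "g (?k z) = snd z" if "z \<in> carrier (direct_sum2 N M)" for z
      using that cl gs ex(5) by (auto simp: carrier_direct_sum2 rhom_add[OF ex(2)])
    have inj: "inj_on ?k (carrier (direct_sum2 N M))"
    proof (rule inj_onI)
      fix z z' assume z: "z \<in> carrier (direct_sum2 N M)" "z' \<in> carrier (direct_sum2 N M)"
        and eq: "?k z = ?k z'"
      then have "snd z = snd z'" using gk by metis
      moreover have "f (fst z) = f (fst z')"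
        using eq z cl \<open>snd z = snd z'\<close>
        by (auto simp: carrier_direct_sum2)
      ultimately show "z = z'"
        using z inj_onD[OF ex(4)] by (auto simp: carrier_direct_sum2 prod_eq_iff)
    qed
    have surj: "?k ` carrier (direct_sum2 N M) = carrier E"
    proof
      show "?k ` carrier (direct_sum2 N M) \<subseteq> carrier E"
        using rhom_closed[OF k] by blast
      show "carrier E \<subseteq> ?k ` carrier (direct_sum2 N M)"
      proof
        fix y assume y: "y \<in> carrier E"
        have "g (y \<ominus>\<^bsub>E\<^esub> s (g y)) = \<zero>\<^bsub>M\<^esub>"
          using y cl gs by (simp add: rhom_minus[OF E M ex(2)] M.minus_eq_zero_iff)
        then obtain n where n: "n \<in> carrier N" "y \<ominus>\<^bsub>E\<^esub> s (g y) = f n"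
          using ex(6)[of "y \<ominus>\<^bsub>E\<^esub> s (g y)"] y cl by auto
        have "y = ?k (n, g y)"
          using y cl by (simp add: n(2)[symmetric] a_minus_def E.M.a_assoc E.M.l_neg)
        moreover have "(n, g y) \<in> carrier (direct_sum2 N M)"
          using n y cl by (simp add: carrier_direct_sum2)
        ultimately show "y \<in> ?k ` carrier (direct_sum2 N M)" by (rule image_eqI)
      qed
    qed
    have kiso: "?k \<in> riso R (direct_sum2 N M) E"
      using k inj surj by (simp add: riso_def bij_betw_def)
    let ?h = "inv_into (carrier (direct_sum2 N M)) ?k"
    have hk: "?h (?k z) = z" if "z \<in> carrier (direct_sum2 N M)" for z
      by (rule inv_into_f_f[OF inj that])
    have "?h (f x) = (x, \<zero>\<^bsub>M\<^esub>)" if "x \<in> carrier N" for x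
      using hk[of "(x, \<zero>\<^bsub>M\<^esub>)"] that cl
      by (simp add: carrier_direct_sum2 rhom_zero[OF M E s])
    moreover have "snd (?h y) = g y" if y: "y \<in> carrier E" for y
    proof -
      obtain z where z: "z \<in> carrier (direct_sum2 N M)" "y = ?k z"
        using y surj by blast
      show ?thesis unfolding z(2) hk[OF z(1)] gk[OF z(1)] ..
    qed
    ultimately show ?thesis
      using riso_inv[OF D kiso] by (auto simp: ext_equiv_def)
  qed
qed

lemma ext_equiv_join:
  assumes "right_module R E'"
    and "short_exact R N f E g M" "short_exact R N f' E' g' M"
    and "ext_equiv R N (E, f, g) (D, i, p)" "ext_equiv R N (E', f', g') (D, i, p)"
  shows "ext_equiv R N (E, f, g) (E', f', g')"
proof -
  obtain h h' where h: "h \<in> riso R E D" "\<forall>x\<in>carrier N. h (f x) = i x" "\<forall>y\<in>carrier E. p (h y) = g y"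
    and h': "h' \<in> riso R E' D" "\<forall>x\<in>carrier N. h' (f' x) = i x" "\<forall>y\<in>carrier E'. p (h' y) = g' y"
    using assms(4,5) by (auto simp: ext_equiv_def)
  let ?k = "inv_into (carrier E') h'"
  have k: "?k \<in> riso R D E'"
    by (rule riso_inv[OF assms(1) h'(1)])
  have inj: "inj_on h' (carrier E')" and im: "h' ` carrier E' = carrier D"
    using h'(1) by (auto simp: riso_def bij_betw_def)
  have "?k (h (f x)) = f' x" if "x \<in> carrier N" for x
    using that h(2) h'(2) inj rhom_closed[OF short_exactD(1)[OF assms(3)]] by (metis inv_into_f_f)
  moreover have "g' (?k (h y)) = g y" if "y \<in> carrier E" for y
  proof -
    have "h y \<in> carrier D"
      using h(1) that by (auto simp: riso_def bij_betw_def)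
    then have "?k (h y) \<in> carrier E'" "h' (?k (h y)) = h y"
      using im by (metis inv_into_into, metis f_inv_into_f)
    then show ?thesis using h(3) h'(3) that by metis
  qed
  ultimately show ?thesis
    unfolding ext_equiv_def by (auto intro!: bexI[OF _ riso_comp[OF h(1) k]])
qed

definition biproduct where
  "biproduct R M N P i j p q \<longleftrightarrow>
     i \<in> rhom R M P \<and> j \<in> rhom R N P \<and> p \<in> rhom R P M \<and> q \<in> rhom R P N \<and>
     (\<forall>x\<in>carrier M. p (i x) = x \<and> q (i x) = \<zero>\<^bsub>N\<^esub>) \<and>
     (\<forall>y\<in>carrier N. q (j y) = y \<and> p (j y) = \<zero>\<^bsub>M\<^esub>) \<and>
     (\<forall>z\<in>carrier P. i (p z) \<oplus>\<^bsub>P\<^esub> j (q z) = z)"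

lemma biproductI:
  assumes "i \<in> rhom R M P" "j \<in> rhom R N P" "p \<in> rhom R P M" "q \<in> rhom R P N"
    "\<And>x. x \<in> carrier M \<Longrightarrow> p (i x) = x" "\<And>y. y \<in> carrier N \<Longrightarrow> q (j y) = y"
    "\<And>x. x \<in> carrier M \<Longrightarrow> q (i x) = \<zero>\<^bsub>N\<^esub>" "\<And>y. y \<in> carrier N \<Longrightarrow> p (j y) = \<zero>\<^bsub>M\<^esub>"
    "\<And>z. z \<in> carrier P \<Longrightarrow> i (p z) \<oplus>\<^bsub>P\<^esub> j (q z) = z"
  shows "biproduct R M N P i j p q"
  using assms by (simp add: biproduct_def)

lemma biproductD:
  assumes "biproduct R M N P i j p q"
  shows "i \<in> rhom R M P" "j \<in> rhom R N P" "p \<in> rhom R P M" "q \<in> rhom R P N"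
    "\<And>x. x \<in> carrier M \<Longrightarrow> p (i x) = x" "\<And>y. y \<in> carrier N \<Longrightarrow> q (j y) = y"
    "\<And>x. x \<in> carrier M \<Longrightarrow> q (i x) = \<zero>\<^bsub>N\<^esub>" "\<And>y. y \<in> carrier N \<Longrightarrow> p (j y) = \<zero>\<^bsub>M\<^esub>"
    "\<And>z. z \<in> carrier P \<Longrightarrow> i (p z) \<oplus>\<^bsub>P\<^esub> j (q z) = z"
  using assms by (simp_all add: biproduct_def)

context module_category
begin

lemma submodule_copy:
  fixes M :: "('a, 'c) rmodule"
  assumes "right_module R M" "usmall (carrier M)" "submodule R M S"
  obtains P :: "('a, 'u) rmodule" and i
  where "P \<in> MOD" "i \<in> rhom R P M" "inj_on i (carrier P)" "i ` carrier P = S"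
proof -
  let ?S = "M\<lparr>carrier := S\<rparr>"
  have Ssub: "S \<subseteq> carrier M"
    using assms(3) by (simp add: submodule_def)
  have S: "right_module R ?S"
    by (rule submodule_right_module[OF assms(1,3)])
  have "usmall (carrier ?S)"
    using assms(2) Ssub usmall_subset by simp
  then obtain P :: "('a, 'u) rmodule" and r where P: "P \<in> MOD" and r: "r \<in> riso R ?S P"
    using small_copy[OF S] by blast
  let ?i = "inv_into S r"
  have i: "?i \<in> riso R P ?S"
    using riso_inv[OF S r] by simp
  show ?thesis
  proof (rule that[OF P])
    show "?i \<in> rhom R P M"
      using i Ssub by (auto simp: riso_def rhom_def Pi_iff)
    show "inj_on ?i (carrier P)" "?i ` carrier P = S"
      using i by (auto simp: riso_def bij_betw_def)
  qed
qed

lemma biproduct_exists: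
  fixes M :: "('a, 'u) rmodule" and N :: "('a, 'u) rmodule"
  assumes M: "M \<in> MOD" and N: "N \<in> MOD"
  obtains P :: "('a, 'u) rmodule" and i j p q where "P \<in> MOD" "biproduct R M N P i j p q"
proof -
  note m = ModD(1)[OF M] and n = ModD(1)[OF N]
  let ?D = "direct_sum2 M N"
  interpret M: right_module R M by (rule m)
  interpret N: right_module R N by (rule n)
  have D: "right_module R ?D"
    by (rule direct_sum2_right_module[OF m n])
  have "usmall (carrier ?D)"
    using M N by (simp add: carrier_direct_sum2 usmall_Times ModD(2))
  then obtain P :: "('a, 'u) rmodule" and r where P: "P \<in> MOD" and r: "r \<in> riso R ?D P"
    using small_copy[OF D] by blast
  let ?s = "inv_into (carrier ?D) r"
  have s: "?s \<in> rhom R P ?D"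
    using riso_inv[OF D r] by (simp add: riso_def)
  have rr: "r \<in> rhom R ?D P" and inj: "inj_on r (carrier ?D)" and surj: "r ` carrier ?D = carrier P"
    using r by (auto simp: riso_def bij_betw_def)
  have sr: "?s (r z) = z" if "z \<in> carrier ?D" for z
    using inj that by simp
  have rs: "r (?s z) = z" if "z \<in> carrier P" for z
    using surj that f_inv_into_f by metis
  note d = direct_sum2_rhoms[OF m n]
  show ?thesis
  proof (rule that[OF P biproductI[OF rhom_comp[OF d(3) rr] rhom_comp[OF d(4) rr]
          rhom_comp[OF s d(1)] rhom_comp[OF s d(2)]]])
    fix z assume z: "z \<in> carrier P"
    then have sz: "?s z \<in> carrier ?D"
      by (rule rhom_closed[OF s])
    then have "(fst (?s z), \<zero>\<^bsub>N\<^esub>) \<in> carrier ?D" "(\<zero>\<^bsub>M\<^esub>, snd (?s z)) \<in> carrier ?D"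
      by (auto simp: carrier_direct_sum2)
    moreover have "(fst (?s z), \<zero>\<^bsub>N\<^esub>) \<oplus>\<^bsub>?D\<^esub> (\<zero>\<^bsub>M\<^esub>, snd (?s z)) = ?s z"
      using sz by (auto simp: direct_sum2_def)
    ultimately show "r (fst (?s z), \<zero>\<^bsub>N\<^esub>) \<oplus>\<^bsub>P\<^esub> r (\<zero>\<^bsub>M\<^esub>, snd (?s z)) = z"
      by (metis rhom_add[OF rr] rs[OF z])
  qed (auto simp: sr[unfolded carrier_direct_sum2] carrier_direct_sum2)
qed

lemma biproduct_short_exact:
  fixes M :: "('a, 'u) rmodule" and N :: "('a, 'u) rmodule" and P :: "('a, 'u) rmodule"
  assumes "M \<in> MOD" "N \<in> MOD" "P \<in> MOD" and bip: "biproduct R M N P i j p q"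
  shows "short_exact R M i P q N"
proof -
  note b = biproductD[OF bip]
  interpret P: right_module R P by (rule ModD[OF assms(3)])
  have "z \<in> i ` carrier M" if "z \<in> carrier P" "q z = \<zero>\<^bsub>N\<^esub>" for z
  proof -
    have "i (p z) = z"
      using b(9)[OF that(1)] rhom_zero[OF ModD(1) ModD(1) b(2)] assms(2,3) that
        rhom_closed[OF b(1)] rhom_closed[OF b(3)] by simp
    then show ?thesis using rhom_closed[OF b(3) that(1)] by force
  qed
  moreover have "inj_on i (carrier M)"
    using b(5) by (rule inj_on_inverseI)
  moreover have "carrier N \<subseteq> q ` carrier P"
    using b(6)[symmetric] rhom_closed[OF b(2)] by blast
  ultimately show ?thesis
    using b(1,4,7) rhom_closed[OF b(1)] rhom_closed[OF b(4)]
    by (auto simp: short_exact_def right_exact_def repi_def rkernel_def)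
qed

lemma extensions_nonempty:
  fixes M :: "('a, 'u) rmodule"
  assumes M: "M \<in> MOD" and N: "N \<in> MOD"
  shows "extensions R M N \<noteq> {}"
proof -
  obtain P :: "('a, 'u) rmodule" and i j p q where P: "P \<in> MOD" "biproduct R N M P i j p q"
    using biproduct_exists[OF N M] by blast
  then have "(P, i, q) \<in> extensions R M N"
    using biproduct_short_exact[OF N M P] by (simp add: extensions_def)
  then show ?thesis by blast
qed

text \<open>
  All split extensions are equivalent to the trivial one, hence to each other, so that they form a
  single class, the one of the trivial extension. The quotient set contains it because the trivial
  extension has a copy in the universe.
\<close>

lemma Ext_projective_iff_split:
  fixes \<T> :: "('a, 'u) rmodule set"
  assumes T: "\<T> \<subseteq> MOD"
  shows "Ext_projective R \<T> M \<longleftrightarrow> M \<in> \<T> \<and> (\<forall>N\<in>\<T>. \<forall>E\<in>MOD. \<forall>f g. short_exact R N f E g M \<longrightarrow>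
    (\<exists>s\<in>rhom R M E. \<forall>x\<in>carrier M. g (s x) = x))"
proof -
  have key: "Ext1 R M N = {Ext1_zero R M N} \<longleftrightarrow> (\<forall>E\<in>MOD. \<forall>f g. short_exact R N f E g M \<longrightarrow>
    (\<exists>s\<in>rhom R M E. \<forall>x\<in>carrier M. g (s x) = x))" if M: "M \<in> \<T>" and N: "N \<in> \<T>" for N
  proof
    let ?X = "extensions R M N"
    let ?r = "{(e, e'). e \<in> ?X \<and> e' \<in> ?X \<and> ext_equiv R N e e'}"
    let ?triv = "(direct_sum2 N M, (\<lambda>x. (x, \<zero>\<^bsub>M\<^esub>)), snd)"
    have m: "right_module R M" "M \<in> MOD" and n: "right_module R N" "N \<in> MOD"
      using M N T ModD(1) by blast+
    have triv: "ext_equiv R N (E, f, g) ?triv \<longleftrightarrow> (\<exists>s\<in>rhom R M E. \<forall>x\<in>carrier M. g (s x) = x)"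
      if "E \<in> MOD" "short_exact R N f E g M" for E f g
      using ext_equiv_trivial_iff[OF n(1) ModD(1)[OF that(1)] m(1) that(2)] .
    show "\<forall>E\<in>MOD. \<forall>f g. short_exact R N f E g M \<longrightarrow>
        (\<exists>s\<in>rhom R M E. \<forall>x\<in>carrier M. g (s x) = x)"
      if eq: "Ext1 R M N = {Ext1_zero R M N}"
    proof (intro ballI allI impI)
      fix E :: "('a, 'u) rmodule" and f g assume E: "E \<in> MOD" and ex: "short_exact R N f E g M"
      then have e: "(E, f, g) \<in> ?X" by (simp add: extensions_def)
      have "(\<lambda>x. x) \<in> riso R E E"
        by (simp add: riso_def rhom_id bij_betw_def)
      then have "ext_equiv R N (E, f, g) (E, f, g)"
        by (auto simp: ext_equiv_def)
      then have mem: "(E, f, g) \<in> ?r `` {(E, f, g)}"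
        using e by simp
      have "?r `` {(E, f, g)} \<in> Ext1 R M N"
        using e unfolding Ext1_def by (rule quotientI)
      then have cls: "?r `` {(E, f, g)} = Ext1_zero R M N"
        unfolding eq by (rule singletonD)
      have "(E, f, g) \<in> Ext1_zero R M N"
        by (rule subst[OF cls, of "\<lambda>S. (E, f, g) \<in> S"]) (rule mem)
      then have "ext_equiv R N (E, f, g) ?triv"
        by (simp add: Ext1_zero_def)
      then show "\<exists>s\<in>rhom R M E. \<forall>x\<in>carrier M. g (s x) = x"
        using triv[OF E ex] by blast
    qed
    show "Ext1 R M N = {Ext1_zero R M N}"
      if split: "\<forall>E\<in>MOD. \<forall>f g. short_exact R N f E g M \<longrightarrow>
        (\<exists>s\<in>rhom R M E. \<forall>x\<in>carrier M. g (s x) = x)"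
    proof -
      have all: "ext_equiv R N (E, f, g) ?triv" if "(E, f, g) \<in> ?X" for E f g
        using that split triv by (auto simp: extensions_def)
      have zero: "Ext1_zero R M N = ?X"
        using all by (auto simp: Ext1_zero_def)
      have eqv: "ext_equiv R N e e'" if "e \<in> ?X" "e' \<in> ?X" for e e'
      proof -
        obtain E f g E' f' g' where eq: "e = (E, f, g)" "e' = (E', f', g')"
          by (metis prod_cases3)
        have E': "E' \<in> MOD" and ex: "short_exact R N f E g M" "short_exact R N f' E' g' M"
          using that unfolding eq by (auto simp: extensions_def)
        show ?thesis
          unfolding eq
          by (rule ext_equiv_join[OF ModD(1)[OF E'] ex all all]) (use that eq in simp_all)
      qed
      have cls: "?r `` {e} = ?X" if "e \<in> ?X" for e
      proof (rule Set.set_eqI)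
        show "x \<in> ?r `` {e} \<longleftrightarrow> x \<in> ?X" for x
          by (cases "x \<in> ?X") (simp_all add: that eqv)
      qed
      show ?thesis
        unfolding Ext1_def quotient_def zero using cls extensions_nonempty[OF m(2) n(2)] by auto
    qed
  qed
  show ?thesis
    by (simp add: Ext_projective_def key cong: conj_cong)
qed

lemma Ext_projective_in: "Ext_projective R \<T> M \<Longrightarrow> M \<in> \<T>"
  by (simp add: Ext_projective_def)

text \<open>
  Pulling the extension back along \<open>f\<close> gives an extension of \<open>M\<close> by \<open>N\<close>. A section of it, followed by
  the projection to \<open>E\<close>, is the lift.
\<close>

lemma Ext_projective_lift:
  fixes \<T> :: "('a, 'u) rmodule set"
  assumes T: "\<T> \<subseteq> MOD" and M: "Ext_projective R \<T> M"
    and N: "N \<in> \<T>" and E: "E \<in> MOD" and Q: "Q \<in> MOD"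
    and ex: "short_exact R N k E p Q" and f: "f \<in> rhom R M Q"
  shows "\<exists>s\<in>rhom R M E. \<forall>x\<in>carrier M. p (s x) = f x"
proof -
  have Mm: "M \<in> MOD" and Nm: "N \<in> MOD"
    using Ext_projective_in[OF M] N T by auto
  note m = ModD(1)[OF Mm] and n = ModD(1)[OF Nm] and e = ModD(1)[OF E] and q = ModD(1)[OF Q]
  note ex = short_exactD[OF ex]
  interpret M: right_module R M by (rule m)
  interpret E: right_module R E by (rule e)
  interpret Q: right_module R Q by (rule q)
  let ?D = "direct_sum2 M E"
  let ?d = "\<lambda>z. f (fst z) \<ominus>\<^bsub>Q\<^esub> p (snd z)"
  note D = direct_sum2_right_module[OF m e] and d = direct_sum2_rhoms[OF m e]
  have dif: "?d \<in> rhom R ?D Q"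
    by (intro rhom_diff q rhom_comp[OF d(1) f] rhom_comp[OF d(2) ex(2)])
  have small: "usmall (carrier ?D)"
    using Mm E by (simp add: carrier_direct_sum2 usmall_Times ModD(2))
  have kernel: "z \<in> rkernel ?D Q ?d \<longleftrightarrow> fst z \<in> carrier M \<and> snd z \<in> carrier E \<and> f (fst z) = p (snd z)" for z
    using rhom_closed[OF f] rhom_closed[OF ex(2)]
    by (auto simp: rkernel_def carrier_direct_sum2 Q.minus_eq_zero_iff mem_Times_iff)
  obtain P :: "('a, 'u) rmodule" and i where P: "P \<in> MOD" and i: "i \<in> rhom R P ?D"
    and inj: "inj_on i (carrier P)" and im: "i ` carrier P = rkernel ?D Q ?d"
    by (rule submodule_copy[OF D small rkernel_submodule[OF D q dif]], rule that)
  have ip: "fst (i z) \<in> carrier M" "snd (i z) \<in> carrier E" "f (fst (i z)) = p (snd (i z))"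
    if "z \<in> carrier P" for z
  proof -
    have "i z \<in> rkernel ?D Q ?d"
      unfolding im[symmetric] using that by (rule imageI)
    then show "fst (i z) \<in> carrier M" "snd (i z) \<in> carrier E" "f (fst (i z)) = p (snd (i z))"
      unfolding kernel by auto
  qed
  have k0: "(\<lambda>x. (\<zero>\<^bsub>M\<^esub>, k x)) \<in> rhom R N ?D"
    by (rule rhom_comp[OF ex(1) d(4)])
  have k1: "(\<lambda>x. (\<zero>\<^bsub>M\<^esub>, k x)) ` carrier N \<subseteq> i ` carrier P"
    unfolding im using ex(5) rhom_closed[OF ex(1)] rhom_zero[OF m q f] by (auto simp: kernel)
  obtain k' where k': "k' \<in> rhom R N P" "\<forall>x\<in>carrier N. i (k' x) = (\<zero>\<^bsub>M\<^esub>, k x)"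
    using factor_through_mono[OF n ModD(1)[OF P] i inj k0 k1] by blast
  have "short_exact R N k' P (\<lambda>z. fst (i z)) M"
    unfolding short_exact_def right_exact_def
  proof (intro conjI)
    show "k' \<in> rhom R N P" by fact
    show "inj_on k' (carrier N)"
    proof (rule inj_onI)
      fix x y assume xy: "x \<in> carrier N" "y \<in> carrier N" and "k' x = k' y"
      then have "(\<zero>\<^bsub>M\<^esub>, k x) = (\<zero>\<^bsub>M\<^esub>, k y)" using k'(2) by metis
      then show "x = y" using inj_onD[OF ex(4)] xy by simp
    qed
    show "(\<lambda>z. fst (i z)) \<in> repi R P M"
      unfolding repi_def
    proof (intro CollectI conjI rhom_comp[OF i d(1)] subset_antisym)
      show "(\<lambda>z. fst (i z)) ` carrier P \<subseteq> carrier M" using ip by auto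
      show "carrier M \<subseteq> (\<lambda>z. fst (i z)) ` carrier P"
      proof
        fix x assume x: "x \<in> carrier M"
        then obtain y where "y \<in> carrier E" "f x = p y"
          using ex(3) rhom_closed[OF f] by (metis imageE)
        then have "(x, y) \<in> i ` carrier P" unfolding im using x kernel by simp
        then obtain z where z: "z \<in> carrier P" "(x, y) = i z" by blast
        show "x \<in> (\<lambda>z. fst (i z)) ` carrier P"
          by (rule image_eqI[OF _ z(1)]) (simp add: z(2)[symmetric])
      qed
    qed
    show "k' ` carrier N = rkernel P M (\<lambda>z. fst (i z))"
    proof
      show "k' ` carrier N \<subseteq> rkernel P M (\<lambda>z. fst (i z))"
        using k' rhom_closed[OF k'(1)] by (auto simp: rkernel_def)
      show "rkernel P M (\<lambda>z. fst (i z)) \<subseteq> k' ` carrier N"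
      proof
        fix z assume "z \<in> rkernel P M (\<lambda>z. fst (i z))"
        then have z: "z \<in> carrier P" "fst (i z) = \<zero>\<^bsub>M\<^esub>"
          by (auto simp: rkernel_def)
        then have "p (snd (i z)) = \<zero>\<^bsub>Q\<^esub>"
          using ip rhom_zero[OF m q f] by metis
        then obtain x where x: "x \<in> carrier N" "snd (i z) = k x"
          using ex(6) ip(2) z(1) by blast
        then have "i z = i (k' x)"
          using k'(2) z(2) by (simp add: prod_eq_iff)
        then have "z = k' x"
          using inj_onD[OF inj] z(1) rhom_closed[OF k'(1) x(1)] by blast
        then show "z \<in> k' ` carrier N" using x(1) by blast
      qed
    qed
  qed
  then obtain s where s: "s \<in> rhom R M P" "\<forall>x\<in>carrier M. fst (i (s x)) = x"
    using M N P unfolding Ext_projective_iff_split[OF T] by blast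
  show ?thesis
  proof (intro bexI ballI)
    show "(\<lambda>x. snd (i (s x))) \<in> rhom R M E"
      by (rule rhom_comp[OF s(1) rhom_comp[OF i d(2)]])
    show "p (snd (i (s x))) = f x" if "x \<in> carrier M" for x
      using ip(3)[OF rhom_closed[OF s(1) that]] s(2) that by simp
  qed
qed

lemma Ext_projectiveI:
  fixes \<T> :: "('a, 'u) rmodule set" and M :: "('a, 'u) rmodule"
  assumes "\<T> \<subseteq> MOD" "M \<in> \<T>"
    and "\<And>N E f g. N \<in> \<T> \<Longrightarrow> E \<in> MOD \<Longrightarrow> short_exact R N f E g M \<Longrightarrow>
      \<exists>s\<in>rhom R M E. \<forall>x\<in>carrier M. g (s x) = x"
  shows "Ext_projective R \<T> M"
  unfolding Ext_projective_iff_split[OF assms(1)] using assms(2,3) by simp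

end

section \<open>Torsion classes, \<open>Add\<close> and \<open>Gen\<close>\<close>

lemma coproduct_rhom_eq:
  assumes cop: "coproduct R I F P \<iota>" and P: "right_module R P" and N: "right_module R N"
    and f: "f \<in> rhom R P N" and g: "g \<in> rhom R P N"
    and eq: "\<And>i t. i \<in> I \<Longrightarrow> t \<in> carrier (F i) \<Longrightarrow> f (\<iota> i t) = g (\<iota> i t)"
    and x: "x \<in> carrier P"
  shows "f x = g x"
  by (rule coproduct_induct[OF cop x _ _ _ P])
    (simp_all add: rhom_zero[OF P N f] rhom_zero[OF P N g] rhom_add[OF f] rhom_add[OF g] eq)

context module_category
begin

lemma small_iff: "small (I :: 'u set) \<longleftrightarrow> usmall I"
  by (simp add: small_def small_in_def)

text \<open>
  The complement of the retract \<open>X\<close> is the kernel of the retraction \<open>p\<close>.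
\<close>

lemma Add_retract:
  fixes T :: "('a, 'u) rmodule" and I :: "'u set"
  assumes T: "T \<in> MOD" and X: "X \<in> MOD" and P: "P \<in> MOD" and I: "usmall I"
    and cop: "coproduct R I (\<lambda>_. T) P \<iota>"
    and i: "i \<in> rhom R X P" and p: "p \<in> rhom R P X" and pi: "\<And>x. x \<in> carrier X \<Longrightarrow> p (i x) = x"
  shows "X \<in> Add R T"
proof -
  note x = ModD(1)[OF X] and pm = ModD(1)[OF P]
  obtain N :: "('a, 'u) rmodule" and j where N: "N \<in> MOD" and j: "j \<in> rhom R N P"
    "inj_on j (carrier N)" "j ` carrier N = rkernel P X p"
    by (rule submodule_copy[OF pm ModD(2)[OF P] rkernel_submodule[OF pm x p]], rule that)
  note n = ModD(1)[OF N]
  have "carrier X \<subseteq> p ` carrier P"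
    using pi[symmetric] rhom_closed[OF i] by blast
  then have "p \<in> repi R P X"
    using p rhom_closed[OF p] by (auto simp: repi_def)
  then have ex: "short_exact R N j P p X"
    using j by (simp add: short_exact_def right_exact_def)
  have "ext_equiv R N (P, j, p) (direct_sum2 N X, (\<lambda>y. (y, \<zero>\<^bsub>X\<^esub>)), snd)"
    unfolding ext_equiv_trivial_iff[OF n pm x ex] using i pi by (intro bexI[of _ i] ballI)
  then obtain h where h: "h \<in> riso R P (direct_sum2 N X)"
    by (auto simp: ext_equiv_def)
  obtain r where r: "r \<in> riso R (direct_sum I (\<lambda>_. T)) P"
    using coproduct_iso[OF cop] by blast
  have "(\<lambda>z. (snd z, fst z)) \<in> riso R (direct_sum2 X N) (direct_sum2 N X)"
    unfolding riso_def
    by (auto simp: direct_sum2_def intro!: rhomI bij_betwI[of _ _ _ "\<lambda>z. (snd z, fst z)"])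
  from riso_comp[OF riso_comp[OF this riso_inv[OF pm h]] riso_inv[OF _ r]]
  have "riso R (direct_sum2 X N) (direct_sum I (\<lambda>_. T)) \<noteq> {}"
    using direct_sum_right_module[OF ring, of I "\<lambda>_. T"] ModD(1)[OF T] by auto
  then show ?thesis
    using X N I by (auto simp: Add_def small_iff)
qed

lemma Add_coproduct:
  fixes T :: "('a, 'u) rmodule" and J :: "'u set" and F :: "'u \<Rightarrow> ('a, 'u) rmodule"
  assumes T: "T \<in> MOD" and M: "M \<in> MOD" and J: "usmall J" and cop: "coproduct R J F M \<kappa>"
    and i: "\<And>j. j \<in> J \<Longrightarrow> i j \<in> rhom R (F j) T" and p: "\<And>j. j \<in> J \<Longrightarrow> p j \<in> rhom R T (F j)"
    and pi: "\<And>j t. j \<in> J \<Longrightarrow> t \<in> carrier (F j) \<Longrightarrow> p j (i j t) = t"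
  shows "M \<in> Add R T"
proof -
  obtain P :: "('a, 'u) rmodule" and \<iota> where P: "P \<in> MOD" and copP: "coproduct R J (\<lambda>_. T) P \<iota>"
    using coproduct_exists[OF J, of "\<lambda>_. T"] T by blast
  note m = ModD(1)[OF M] and pm = ModD(1)[OF P]
  have 1: "(\<lambda>t. \<iota> j (i j t)) \<in> rhom R (F j) P" if "j \<in> J" for j
    by (rule rhom_comp[OF i coproduct_injection[OF copP]]) (rule that)+
  obtain i' where i': "i' \<in> rhom R M P"
      "\<forall>j\<in>J. \<forall>t\<in>carrier (F j). i' (\<kappa> j t) = \<iota> j (i j t)"
    using coproduct_universal[OF cop pm, where f = "\<lambda>j t. \<iota> j (i j t)", OF 1] by blast
  have 2: "(\<lambda>t. \<kappa> j (p j t)) \<in> rhom R T M" if "j \<in> J" for j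
    by (rule rhom_comp[OF p coproduct_injection[OF cop]]) (rule that)+
  obtain p' where p': "p' \<in> rhom R P M"
      "\<forall>j\<in>J. \<forall>t\<in>carrier T. p' (\<iota> j t) = \<kappa> j (p j t)"
    using coproduct_universal[OF copP m, where f = "\<lambda>j t. \<kappa> j (p j t)", OF 2] by blast
  have "p' (i' x) = x" if "x \<in> carrier M" for x
    by (rule coproduct_rhom_eq[OF cop m m rhom_comp[OF i'(1) p'(1)] rhom_id _ that])
      (simp add: i' p' pi rhom_closed[OF i])
  then show ?thesis
    by (rule Add_retract[OF T M P J copP i'(1) p'(1)])
qed

lemma Gen_elim:
  fixes T :: "('a, 'u) rmodule"
  assumes T: "T \<in> MOD" and N: "N \<in> Gen R T"
  obtains I :: "'u set" and P :: "('a, 'u) rmodule" and \<iota> p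
  where "usmall I" "P \<in> MOD" "coproduct R I (\<lambda>_. T) P \<iota>" "p \<in> repi R P N"
proof -
  obtain X e where X: "X \<in> Add R T" and e: "e \<in> repi R X N"
    using N by (auto simp: Gen_def)
  obtain N' :: "('a, 'u) rmodule" and I :: "'u set" and h
    where N': "N' \<in> MOD" and I: "usmall I" and h: "h \<in> riso R (direct_sum2 X N') (direct_sum I (\<lambda>_. T))"
    using X by (auto simp: Add_def small_iff)
  have x: "right_module R X"
    using X by (auto simp: Add_def intro: ModD)
  note n' = ModD(1)[OF N']
  obtain P :: "('a, 'u) rmodule" and \<iota> where P: "P \<in> MOD" and cop: "coproduct R I (\<lambda>_. T) P \<iota>"
    using coproduct_exists[OF I, of "\<lambda>_. T"] T by blast
  obtain r where r: "r \<in> riso R (direct_sum I (\<lambda>_. T)) P"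
    using coproduct_iso[OF cop] by blast
  interpret N': right_module R N' by (rule n')
  have D: "right_module R (direct_sum I (\<lambda>_. T))"
    using direct_sum_right_module[OF ring, of I "\<lambda>_. T"] ModD(1)[OF T] by blast
  have "fst ` carrier (direct_sum2 X N') = carrier X"
    unfolding carrier_direct_sum2 using N'.M.zero_closed by (auto simp: fst_image_times)
  then have "fst \<in> repi R (direct_sum2 X N') X"
    using direct_sum2_rhoms(1)[OF x n'] by (simp add: repi_def)
  note * = subsetD[OF riso_repi riso_inv[OF D r]]
    subsetD[OF riso_repi riso_inv[OF direct_sum2_right_module[OF x n'] h]] this e
  show ?thesis
    by (rule that[OF I P cop repi_comp[OF *(1) repi_comp[OF *(2) repi_comp[OF *(3,4)]]]])
qed

lemma Pres_subset_Gen: "Pres R T \<subseteq> Gen R (T :: ('a, 'u) rmodule)"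
  by (auto simp: Pres_def Gen_def right_exact_def)

end

locale torsion_theory = module_category R U for R :: "'a ring" and U :: "'u itself" +
  fixes \<T> :: "('a, 'u) rmodule set"
  assumes torsion: "torsion_class R \<T>"
begin

lemma T_subset: "\<T> \<subseteq> MOD"
  using torsion by (simp add: torsion_class_def)

lemma T_Mod: "M \<in> \<T> \<Longrightarrow> M \<in> MOD"
  using T_subset by blast

lemma T_quotient: "M \<in> \<T> \<Longrightarrow> N \<in> MOD \<Longrightarrow> f \<in> repi R M N \<Longrightarrow> N \<in> \<T>"
  using torsion unfolding torsion_class_def by blast

lemma T_extension:
  assumes "L \<in> \<T>" "N \<in> \<T>" "M \<in> MOD" "short_exact R L f M g N"
  shows "M \<in> \<T>"
proof -
  have *: "\<forall>L\<in>\<T>. \<forall>N\<in>\<T>. \<forall>M\<in>MOD. (\<exists>f g. short_exact R L f M g N) \<longrightarrow> M \<in> \<T>"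
    using torsion unfolding torsion_class_def by (elim conjE) assumption
  show ?thesis
    by (rule *[rule_format, OF assms(1-3)]) (intro exI, rule assms(4))
qed

lemma T_coproduct:
  fixes I :: "'u set"
  assumes "usmall I" "\<And>i. i \<in> I \<Longrightarrow> F i \<in> \<T>" "P \<in> MOD" "coproduct R I F P \<iota>"
  shows "P \<in> \<T>"
proof -
  have *: "\<forall>(I :: 'u set) F. small I \<longrightarrow> (\<forall>i\<in>I. F i \<in> \<T>) \<longrightarrow>
        (\<forall>M\<in>MOD. riso R (direct_sum I F) M \<noteq> {} \<longrightarrow> M \<in> \<T>)"
    using torsion unfolding torsion_class_def by (elim conjE) assumption
  show ?thesis
    by (rule *[rule_format, OF _ _ assms(3) coproduct_iso[OF assms(4)]])
      (simp_all add: small_iff assms(1,2))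
qed

lemma Gen_subset:
  assumes T: "T \<in> \<T>"
  shows "Gen R T \<subseteq> \<T>"
proof
  fix N assume N: "N \<in> Gen R T"
  obtain I :: "'u set" and P :: "('a, 'u) rmodule" and \<iota> p
    where "usmall I" "P \<in> MOD" "coproduct R I (\<lambda>_. T) P \<iota>" "p \<in> repi R P N"
    by (rule Gen_elim[OF T_Mod[OF T] N], rule that)
  moreover from this have "P \<in> \<T>"
    using T_coproduct[of I "\<lambda>_. T"] T by blast
  ultimately show "N \<in> \<T>"
    using T_quotient N by (auto simp: Gen_def)
qed

text \<open>
  Lifting the injection of each summand gives a section on the whole sum.
\<close>

lemma Ext_projective_coproduct:
  fixes I :: "'u set"
  assumes I: "usmall I" and F: "\<And>i. i \<in> I \<Longrightarrow> Ext_projective R \<T> (F i)"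
    and P: "P \<in> MOD" and cop: "coproduct R I F P \<iota>"
  shows "Ext_projective R \<T> P"
proof (rule Ext_projectiveI[OF T_subset])
  show "P \<in> \<T>"
    by (rule T_coproduct[OF I _ P cop]) (rule Ext_projective_in[OF F])
  fix N E f g assume N: "N \<in> \<T>" and E: "E \<in> MOD" and ex: "short_exact R N f E g P"
  note pm = ModD(1)[OF P] and em = ModD(1)[OF E]
  have "\<exists>s\<in>rhom R (F i) E. \<forall>t\<in>carrier (F i). g (s t) = \<iota> i t" if "i \<in> I" for i
    by (rule Ext_projective_lift[OF T_subset F[OF that] N E P ex coproduct_injection[OF cop that]])
  then obtain s where s: "\<And>i. i \<in> I \<Longrightarrow> s i \<in> rhom R (F i) E"
    and gs: "\<And>i t. i \<in> I \<Longrightarrow> t \<in> carrier (F i) \<Longrightarrow> g (s i t) = \<iota> i t"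
    by metis
  obtain s' where s': "s' \<in> rhom R P E" "\<forall>i\<in>I. \<forall>t\<in>carrier (F i). s' (\<iota> i t) = s i t"
    using coproduct_universal[OF cop em, where f = s, OF s] by blast
  show "\<exists>s\<in>rhom R P E. \<forall>x\<in>carrier P. g (s x) = x"
  proof (intro bexI ballI)
    show "g (s' x) = x" if "x \<in> carrier P" for x
      by (rule coproduct_rhom_eq[OF cop pm pm rhom_comp[OF s'(1) short_exactD(2)[OF ex]] rhom_id _ that])
        (simp add: s' gs)
  qed (rule s')
qed

lemma Ext_projective_biproduct:
  assumes M: "Ext_projective R \<T> M" and N: "Ext_projective R \<T> N"
    and P: "P \<in> MOD" and bip: "biproduct R M N P i j p q"
  shows "Ext_projective R \<T> P"
proof (rule Ext_projectiveI[OF T_subset])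
  note mt = Ext_projective_in[OF M] and nt = Ext_projective_in[OF N]
  note b = biproductD[OF bip]
  show "P \<in> \<T>"
    by (rule T_extension[OF mt nt P biproduct_short_exact[OF T_Mod[OF mt] T_Mod[OF nt] P bip]])
  fix L E f g assume L: "L \<in> \<T>" and E: "E \<in> MOD" and ex: "short_exact R L f E g P"
  note em = ModD(1)[OF E]
  obtain s where s: "s \<in> rhom R M E" "\<forall>x\<in>carrier M. g (s x) = i x"
    using Ext_projective_lift[OF T_subset M L E P ex b(1)] by blast
  obtain t where t: "t \<in> rhom R N E" "\<forall>x\<in>carrier N. g (t x) = j x"
    using Ext_projective_lift[OF T_subset N L E P ex b(2)] by blast
  show "\<exists>s\<in>rhom R P E. \<forall>x\<in>carrier P. g (s x) = x"
  proof (intro bexI ballI)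
    show "(\<lambda>z. s (p z) \<oplus>\<^bsub>E\<^esub> t (q z)) \<in> rhom R P E"
      by (intro rhom_plus em rhom_comp[OF b(3) s(1)] rhom_comp[OF b(4) t(1)])
    show "g (s (p z) \<oplus>\<^bsub>E\<^esub> t (q z)) = z" if "z \<in> carrier P" for z
      using that s t b(9) rhom_closed[OF b(3)] rhom_closed[OF b(4)] rhom_closed[OF s(1)] rhom_closed[OF t(1)]
      by (simp add: rhom_add[OF short_exactD(2)[OF ex]])
  qed
qed

end

section \<open>Versal elements\<close>

text \<open>
  Evaluating a homomorphism from the regular module at \<open>1\<close> identifies it with an element. Under
  this identification, \<open>x\<close> is versal precisely if \<open>a \<mapsto> x a\<close> is a left approximation of the regular
  module. Working with \<open>x\<close> avoids free modules: maps out of them are replaced by families of elements.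
\<close>

definition versal :: "'a ring \<Rightarrow> ('a, 'u) rmodule set \<Rightarrow> ('a, 'u) rmodule \<Rightarrow> 'u \<Rightarrow> bool" where
  "versal R \<T> T x \<longleftrightarrow> T \<in> \<T> \<and> x \<in> carrier T \<and>
     (\<forall>N\<in>\<T>. \<forall>n\<in>carrier N. \<exists>g\<in>rhom R T N. g x = n)"

context torsion_theory
begin

text \<open>
  Let \<open>P\<close> be the sum of copies of \<open>T\<close> indexed by the elements \<open>y\<close> of \<open>M\<close>, and let \<open>b y\<close> be the copy of \<open>x\<close>
  in the summand \<open>y\<close>. Any family of elements of a torsion module \<open>N\<close> is the image of the family \<open>b\<close>
  under a homomorphism from \<open>P\<close>. Let \<open>B\<close> be the quotient of \<open>P\<close> by the relations that make \<open>b\<close> linear.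
  Then \<open>M \<rightarrow> B\<close> is an approximation, because a homomorphism \<open>M \<rightarrow> N\<close> is a family that satisfies these
  relations.

  The cokernel \<open>C\<close> is the quotient of \<open>P\<close> by all \<open>b y\<close>. Given an extension \<open>E\<close> of \<open>C\<close> by \<open>N\<close>, lift
  \<open>P \<rightarrow> C\<close> to \<open>\<beta> : P \<rightarrow> E\<close>. The elements \<open>\<beta> (b y)\<close> lie in \<open>N\<close>, hence some \<open>\<gamma> : P \<rightarrow> N\<close> agrees with \<open>\<beta>\<close> on
  the family \<open>b\<close>, and \<open>\<beta> - \<gamma>\<close> factors through \<open>C\<close> and splits the extension.
\<close>

lemma approximation_from_versal:
  assumes T: "Ext_projective R \<T> T" and ver: "versal R \<T> T x" and M: "M \<in> MOD"
  shows "\<exists>B\<in>MOD. \<exists>C\<in>MOD. \<exists>\<phi> \<psi>. right_exact R M \<phi> B \<psi> C \<and>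
    left_approximation R \<T> M \<phi> B \<and> Ext_projective R \<T> C"
proof -
  have TT: "T \<in> \<T>" and x: "x \<in> carrier T"
    and gen: "\<And>N n. N \<in> \<T> \<Longrightarrow> n \<in> carrier N \<Longrightarrow> \<exists>g\<in>rhom R T N. g x = n"
    using ver by (auto simp: versal_def)
  note Tm = T_Mod[OF TT]
  note m = ModD[OF M]
  interpret M: right_module R M by (rule m)
  obtain P :: "('a, 'u) rmodule" and \<iota> where P: "P \<in> MOD"
    and cop: "coproduct R (carrier M) (\<lambda>_. T) P \<iota>"
    using coproduct_exists[OF m(2), of "\<lambda>_. T"] Tm by blast
  note p = ModD[OF P]
  interpret P: right_module R P by (rule p)
  have PT: "P \<in> \<T>"
    by (rule T_coproduct[OF m(2) _ P cop]) (rule TT)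
  have Pproj: "Ext_projective R \<T> P"
    by (rule Ext_projective_coproduct[OF m(2) _ P cop]) (rule T)
  define b where "b y = \<iota> y x" for y
  have b: "b y \<in> carrier P" if "y \<in> carrier M" for y
    unfolding b_def by (rule rhom_closed[OF coproduct_injection[OF cop that] x])
  \<comment> \<open>On torsion modules, \<open>P\<close> is free on the family \<open>b\<close> up to uniqueness.\<close>
  have extend: "\<exists>G\<in>rhom R P N. \<forall>y\<in>carrier M. G (b y) = v y"
    if N: "N \<in> \<T>" and v: "\<And>y. y \<in> carrier M \<Longrightarrow> v y \<in> carrier N" for N v
  proof -
    have "\<exists>g\<in>rhom R T N. g x = v y" if "y \<in> carrier M" for y
      by (rule gen[OF N v[OF that]])
    then obtain g where g: "\<And>y. y \<in> carrier M \<Longrightarrow> g y \<in> rhom R T N"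
      and gx: "\<And>y. y \<in> carrier M \<Longrightarrow> g y x = v y"
      by metis
    obtain G where "G \<in> rhom R P N" "\<forall>y\<in>carrier M. \<forall>t\<in>carrier T. G (\<iota> y t) = g y t"
      using coproduct_universal[OF cop ModD(1)[OF T_Mod[OF N]], where f = g, OF g] by blast
    then show ?thesis using gx x by (intro bexI[of _ G]) (simp_all add: b_def)
  qed
  let ?rel = "{b (y \<oplus>\<^bsub>M\<^esub> z) \<ominus>\<^bsub>P\<^esub> (b y \<oplus>\<^bsub>P\<^esub> b z) |y z. y \<in> carrier M \<and> z \<in> carrier M} \<union>
    {b (y \<odot>\<^bsub>M\<^esub> a) \<ominus>\<^bsub>P\<^esub> b y \<odot>\<^bsub>P\<^esub> a |y a. y \<in> carrier M \<and> a \<in> carrier R}"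
  have rel: "?rel \<subseteq> carrier P"
    using b M.ract_closed P.ract_closed by (auto intro!: P.M.minus_closed)
  obtain B q where B: "right_module R B" "carrier B \<subseteq> carrier P" and q: "q \<in> repi R P B"
    and qk: "rkernel P B q = generated R P ?rel"
    by (rule quotient_exists[OF p(1) generated_submodule[OF p(1) rel]], rule that)
  interpret B: right_module R B by fact
  have BM: "B \<in> MOD"
    using B p(2) usmall_subset by (auto simp: Mod_iff)
  have BT: "B \<in> \<T>"
    by (rule T_quotient[OF PT BM q])
  have qh: "q \<in> rhom R P B" and qi: "q ` carrier P = carrier B"
    using q by (auto simp: repi_def)
  have relq: "q u = \<zero>\<^bsub>B\<^esub>" if "u \<in> ?rel" for u
  proof -
    have "u \<in> rkernel P B q"
      unfolding qk using generated_superset that by (rule subsetD)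
    then show ?thesis by (simp add: rkernel_def)
  qed
  have descend: "\<exists>G'\<in>rhom R B N. \<forall>y\<in>carrier P. G' (q y) = G y"
    if N: "right_module R N" and G: "G \<in> rhom R P N"
      and add: "\<And>y z. y \<in> carrier M \<Longrightarrow> z \<in> carrier M \<Longrightarrow> G (b (y \<oplus>\<^bsub>M\<^esub> z)) = G (b y) \<oplus>\<^bsub>N\<^esub> G (b z)"
      and act: "\<And>y a. y \<in> carrier M \<Longrightarrow> a \<in> carrier R \<Longrightarrow> G (b (y \<odot>\<^bsub>M\<^esub> a)) = G (b y) \<odot>\<^bsub>N\<^esub> a"
    for N :: "('a, 'u) rmodule" and G
  proof (rule factor_through_epi[OF p(1) B(1) N q G])
    interpret N: right_module R N by fact
    have "?rel \<subseteq> rkernel P N G"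
    proof
      fix u assume u: "u \<in> ?rel"
      then have "u \<in> carrier P" using rel by (rule subsetD[rotated])
      moreover have "G u = \<zero>\<^bsub>N\<^esub>"
        using u b rhom_closed[OF G] M.ract_closed P.ract_closed N.ract_closed
        by (auto simp: rhom_minus[OF p(1) N G] rhom_add[OF G] rhom_ract[OF G] add act N.minus_eq_zero_iff)
      ultimately show "u \<in> rkernel P N G" by (simp add: rkernel_def)
    qed
    then have "rkernel P B q \<subseteq> rkernel P N G"
      unfolding qk by (rule generated_least[OF rkernel_submodule[OF p(1) N G]])
    then show "G y = \<zero>\<^bsub>N\<^esub>" if "y \<in> carrier P" "q y = \<zero>\<^bsub>B\<^esub>" for y
      using that by (auto simp: rkernel_def)
  qed
  define \<phi> where "\<phi> y = q (b y)" for y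
  have \<phi>c: "\<phi> y \<in> carrier B" if "y \<in> carrier M" for y
    unfolding \<phi>_def by (rule rhom_closed[OF qh b[OF that]])
  have \<phi>: "\<phi> \<in> rhom R M B"
  proof (rule rhomI[OF \<phi>c])
    fix y z assume yz: "y \<in> carrier M" "z \<in> carrier M"
    then have "q (b (y \<oplus>\<^bsub>M\<^esub> z) \<ominus>\<^bsub>P\<^esub> (b y \<oplus>\<^bsub>P\<^esub> b z)) = \<zero>\<^bsub>B\<^esub>"
      by (intro relq) blast
    then show "\<phi> (y \<oplus>\<^bsub>M\<^esub> z) = \<phi> y \<oplus>\<^bsub>B\<^esub> \<phi> z"
      using yz \<phi>c b by (simp add: rhom_minus[OF p(1) B(1) qh] rhom_add[OF qh] \<phi>_def B.minus_eq_zero_iff)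
  next
    fix y a assume ya: "y \<in> carrier M" "a \<in> carrier R"
    then have "q (b (y \<odot>\<^bsub>M\<^esub> a) \<ominus>\<^bsub>P\<^esub> b y \<odot>\<^bsub>P\<^esub> a) = \<zero>\<^bsub>B\<^esub>"
      by (intro relq) blast
    then show "\<phi> (y \<odot>\<^bsub>M\<^esub> a) = \<phi> y \<odot>\<^bsub>B\<^esub> a"
      using ya \<phi>c[unfolded \<phi>_def] b M.ract_closed P.ract_closed B.ract_closed
      by (simp add: rhom_minus[OF p(1) B(1) qh] rhom_ract[OF qh] \<phi>_def B.minus_eq_zero_iff)
  qed
  obtain C \<psi> where C: "right_module R C" "carrier C \<subseteq> carrier B" and \<psi>: "\<psi> \<in> repi R B C"
    and \<psi>k: "rkernel B C \<psi> = \<phi> ` carrier M"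
    by (rule quotient_exists[OF B(1) rimage_submodule[OF m(1) B(1) \<phi>]], rule that)
  have CM: "C \<in> MOD"
    using C BM usmall_subset by (auto simp: Mod_iff)
  have CT: "C \<in> \<T>"
    by (rule T_quotient[OF BT CM \<psi>])
  have \<psi>h: "\<psi> \<in> rhom R B C" and \<psi>i: "\<psi> ` carrier B = carrier C"
    using \<psi> by (auto simp: repi_def)
  have \<psi>\<phi>: "\<psi> (\<phi> y) = \<zero>\<^bsub>C\<^esub>" if "y \<in> carrier M" for y
  proof -
    have "\<phi> y \<in> rkernel B C \<psi>" unfolding \<psi>k using that by (rule imageI)
    then show ?thesis by (simp add: rkernel_def)
  qed
  have exact: "right_exact R M \<phi> B \<psi> C"
    using \<phi> \<psi> \<psi>k by (simp add: right_exact_def)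
  have approx: "left_approximation R \<T> M \<phi> B"
    unfolding left_approximation_def
  proof (intro conjI ballI BT \<phi>)
    fix N f assume N: "N \<in> \<T>" and f: "f \<in> rhom R M N"
    note n = ModD(1)[OF T_Mod[OF N]]
    obtain G where G: "G \<in> rhom R P N" "\<forall>y\<in>carrier M. G (b y) = f y"
      using extend[OF N, of f, OF rhom_closed[OF f]] by blast
    have "\<exists>G'\<in>rhom R B N. \<forall>y\<in>carrier P. G' (q y) = G y"
      by (rule descend[OF n G(1)]) (simp_all add: G(2) rhom_add[OF f] rhom_ract[OF f] M.ract_closed)
    then obtain G' where G': "G' \<in> rhom R B N" "\<forall>y\<in>carrier P. G' (q y) = G y"
      by blast
    show "\<exists>g\<in>rhom R B N. \<forall>y\<in>carrier M. f y = g (\<phi> y)"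
      by (intro bexI[of _ G'] ballI G') (simp add: \<phi>_def G' G b)
  qed
  have "Ext_projective R \<T> C"
  proof (rule Ext_projectiveI[OF T_subset CT])
    fix N E k r assume N: "N \<in> \<T>" and E: "E \<in> MOD" and ex: "short_exact R N k E r C"
    note e = ModD(1)[OF E] and s = short_exactD[OF ex] and n = ModD(1)[OF T_Mod[OF N]]
    interpret E: right_module R E by (rule e)
    interpret C: right_module R C by fact
    obtain \<beta> where \<beta>: "\<beta> \<in> rhom R P E" "\<forall>y\<in>carrier P. r (\<beta> y) = \<psi> (q y)"
      using Ext_projective_lift[OF T_subset Pproj N E CM ex rhom_comp[OF qh \<psi>h]] by blast
    have "\<exists>v\<in>carrier N. \<beta> (b y) = k v" if "y \<in> carrier M" for y
      using s(6)[OF rhom_closed[OF \<beta>(1) b[OF that]]] \<beta>(2) b[OF that] \<psi>\<phi>[OF that]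
      by (simp add: \<phi>_def)
    then obtain v where v: "\<And>y. y \<in> carrier M \<Longrightarrow> v y \<in> carrier N"
      and \<beta>v: "\<And>y. y \<in> carrier M \<Longrightarrow> \<beta> (b y) = k (v y)"
      by metis
    obtain \<gamma> where \<gamma>: "\<gamma> \<in> rhom R P N" "\<forall>y\<in>carrier M. \<gamma> (b y) = v y"
      using extend[OF N, of v, OF v] by blast
    let ?\<delta> = "\<lambda>y. \<beta> y \<ominus>\<^bsub>E\<^esub> k (\<gamma> y)"
    have \<delta>: "?\<delta> \<in> rhom R P E"
      by (intro rhom_diff e \<beta> rhom_comp[OF \<gamma>(1) s(1)])
    have \<delta>b: "?\<delta> (b y) = \<zero>\<^bsub>E\<^esub>" if "y \<in> carrier M" for y
      using that rhom_closed[OF s(1)] v by (simp add: \<beta>v \<gamma> E.minus_eq_zero_iff)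
    have "\<exists>D\<in>rhom R B E. \<forall>y\<in>carrier P. D (q y) = ?\<delta> y"
      by (rule descend[OF e \<delta>]) (simp_all only: \<delta>b M.M.a_closed M.ract_closed E.M.l_zero E.M.zero_closed E.zero_ract)
    then obtain D where D: "D \<in> rhom R B E" "\<forall>y\<in>carrier P. D (q y) = ?\<delta> y"
      by blast
    have "D y = \<zero>\<^bsub>E\<^esub>" if "y \<in> carrier B" "\<psi> y = \<zero>\<^bsub>C\<^esub>" for y
    proof -
      have "y \<in> \<phi> ` carrier M"
        unfolding \<psi>k[symmetric] using that by (simp add: rkernel_def)
      then obtain z where z: "z \<in> carrier M" "y = \<phi> z" by blast
      show ?thesis
        unfolding z(2) \<phi>_def using D(2) b[OF z(1)] \<delta>b[OF z(1)] by simp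
    qed
    then obtain \<sigma> where \<sigma>: "\<sigma> \<in> rhom R C E" "\<forall>y\<in>carrier B. \<sigma> (\<psi> y) = D y"
      using factor_through_epi[OF B(1) C(1) e \<psi> D(1)] by blast
    have "r (\<sigma> c) = c" if c: "c \<in> carrier C" for c
    proof -
      obtain u where u: "u \<in> carrier B" "c = \<psi> u"
        using c unfolding \<psi>i[symmetric] by blast
      obtain y where y: "y \<in> carrier P" "u = q y"
        using u(1) unfolding qi[symmetric] by blast
      have "r (\<sigma> c) = r (?\<delta> y)"
        using u y \<sigma>(2) D(2) by simp
      also have "\<dots> = r (\<beta> y) \<ominus>\<^bsub>C\<^esub> r (k (\<gamma> y))"
        using y rhom_closed[OF \<beta>(1)] rhom_closed[OF s(1)] rhom_closed[OF \<gamma>(1)]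
        by (simp add: rhom_minus[OF e C(1) s(2)])
      also have "\<dots> = c"
        using s(5)[OF rhom_closed[OF \<gamma>(1) y(1)]] \<beta>(2) u y that
        by (simp add: a_minus_def C.minus_zero)
      finally show ?thesis .
    qed
    then show "\<exists>s\<in>rhom R C E. \<forall>x\<in>carrier C. r (s x) = x"
      using \<sigma>(1) by (intro bexI[of _ \<sigma>] ballI)
  qed
  with exact approx BM CM show ?thesis by blast
qed

text \<open>
  If \<open>X\<close> generates \<open>T\<close> over its endomorphism ring, then the tuple of the elements of \<open>X\<close> is versal in
  the sum of copies of \<open>T\<close> indexed by \<open>X\<close>. The elements that are values at this tuple form a subgroup of
  \<open>N\<close>; it contains the image of each homomorphism \<open>T \<rightarrow> N\<close> by the choice of \<open>X\<close>, and these images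
  generate \<open>N\<close>.
\<close>

lemma versal_from_finendo:
  assumes T: "finendo R T" "Ext_projective R \<T> T" and Gen: "\<T> = Gen R T"
  shows "\<exists>T' x. Ext_projective R \<T> T' \<and> versal R \<T> T' x"
proof -
  have TT: "T \<in> \<T>" by (rule Ext_projective_in[OF T(2)])
  note TM = T_Mod[OF TT]
  note t = ModD(1)[OF TM]
  interpret T: right_module R T by (rule t)
  obtain X where X: "finite X" "X \<subseteq> carrier T"
    and gen: "\<forall>t\<in>carrier T. \<exists>h \<in> X \<rightarrow> rhom R T T. t = (\<Oplus>\<^bsub>T\<^esub>x\<in>X. h x x)"
    using T(1) by (auto simp: finendo_def)
  note Xs = usmall_finite[OF X(1)]
  obtain P :: "('a, 'u) rmodule" and \<iota> where P: "P \<in> MOD" and cop: "coproduct R X (\<lambda>_. T) P \<iota>"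
    using coproduct_exists[OF Xs, of "\<lambda>_. T"] TM by blast
  note p = ModD(1)[OF P]
  interpret P: right_module R P by (rule p)
  have Pproj: "Ext_projective R \<T> P"
    by (rule Ext_projective_coproduct[OF Xs _ P cop]) (rule T(2))
  let ?x = "\<Oplus>\<^bsub>P\<^esub>x\<in>X. \<iota> x x"
  have \<iota>x: "\<iota> x x \<in> carrier P" if "x \<in> X" for x
    using rhom_closed[OF coproduct_injection[OF cop that]] that X(2) by blast
  have xP: "?x \<in> carrier P"
    by (rule P.M.finsum_closed) (use \<iota>x in auto)
  \<comment> \<open>The components of \<open>G\<close> are the endomorphisms \<open>h\<close> that express \<open>u\<close> through \<open>X\<close>.\<close>
  have toT: "\<exists>G\<in>rhom R P T. G ?x = u" if u: "u \<in> carrier T" for u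
  proof -
    obtain h where h: "h \<in> X \<rightarrow> rhom R T T" "u = (\<Oplus>\<^bsub>T\<^esub>x\<in>X. h x x)"
      using gen u by blast
    have hx: "h x \<in> rhom R T T" if "x \<in> X" for x
      using h(1) that by auto
    obtain G where G: "G \<in> rhom R P T" "\<forall>x\<in>X. \<forall>t\<in>carrier T. G (\<iota> x t) = h x t"
      using coproduct_universal[OF cop t, where f = h, OF hx] by blast
    have "G ?x = (\<Oplus>\<^bsub>T\<^esub>x\<in>X. G (\<iota> x x))"
      by (rule rhom_finsum[OF p t G(1) X(1) \<iota>x])
    also have "\<dots> = u"
      unfolding h(2)
      by (rule T.M.finsum_cong') (use G(2) X(2) in \<open>auto intro!: rhom_closed[OF hx]\<close>)
    finally show ?thesis using G(1) by (intro bexI[of _ G])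
  qed
  have "\<exists>g\<in>rhom R P N. g ?x = n" if N: "N \<in> \<T>" and n: "n \<in> carrier N" for N n
  proof -
    have NG: "N \<in> Gen R T" using N Gen by simp
    note nm = ModD(1)[OF T_Mod[OF N]]
    interpret N: right_module R N by (rule nm)
    obtain I :: "'u set" and Q :: "('a, 'u) rmodule" and \<kappa> e
      where Q: "Q \<in> MOD" "coproduct R I (\<lambda>_. T) Q \<kappa>" and e: "e \<in> repi R Q N"
      by (rule Gen_elim[OF TM NG], rule that)
    have eh: "e \<in> rhom R Q N" and ei: "e ` carrier Q = carrier N"
      using e by (auto simp: repi_def)
    note qm = ModD(1)[OF Q(1)]
    have hit: "\<exists>g\<in>rhom R P N. g ?x = e z" if "z \<in> carrier Q" for z
      using Q(2) that
    proof (rule coproduct_induct)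
      show "\<exists>g\<in>rhom R P N. g ?x = e \<zero>\<^bsub>Q\<^esub>"
        by (intro bexI[of _ "\<lambda>_. \<zero>\<^bsub>N\<^esub>"] rhom_const_zero nm) (simp add: rhom_zero[OF qm nm eh])
    next
      fix y z assume yz: "y \<in> carrier Q" "z \<in> carrier Q"
        "\<exists>g\<in>rhom R P N. g ?x = e y" "\<exists>g\<in>rhom R P N. g ?x = e z"
      then obtain g g' where g: "g \<in> rhom R P N" "g ?x = e y" "g' \<in> rhom R P N" "g' ?x = e z"
        by blast
      show "\<exists>g\<in>rhom R P N. g ?x = e (y \<oplus>\<^bsub>Q\<^esub> z)"
        by (intro bexI[of _ "\<lambda>x. g x \<oplus>\<^bsub>N\<^esub> g' x"] rhom_plus nm g) (simp add: g rhom_add[OF eh] yz)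
    next
      fix i u assume iu: "i \<in> I" "u \<in> carrier T"
      obtain G where G: "G \<in> rhom R P T" "G ?x = u"
        using toT[OF iu(2)] by blast
      show "\<exists>g\<in>rhom R P N. g ?x = e (\<kappa> i u)"
      proof (rule bexI)
        show "(\<lambda>x. e (\<kappa> i (G x))) \<in> rhom R P N"
          by (rule rhom_comp[OF G(1) rhom_comp[OF coproduct_injection[OF Q(2) iu(1)] eh]])
      qed (simp add: G)
    qed (rule qm)
    obtain z where z: "z \<in> carrier Q" "n = e z"
      using n unfolding ei[symmetric] by blast
    show ?thesis
      unfolding z(2) by (rule hit[OF z(1)])
  qed
  then have "versal R \<T> P ?x"
    using xP Ext_projective_in[OF Pproj] by (simp add: versal_def)
  with Pproj show ?thesis by blast
qed

end

section \<open>From approximations to a quasitilting module\<close>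

context module_category
begin

lemma regular_module:
  obtains A :: "('a, 'u) rmodule" and u where "A \<in> MOD" "u \<in> carrier A"
    "\<forall>y\<in>carrier A. \<exists>a\<in>carrier R. y = u \<odot>\<^bsub>A\<^esub> a"
    "\<forall>N\<in>MOD. \<forall>n\<in>carrier N. \<exists>f\<in>rhom R A N. f u = n"
proof -
  interpret R: ring R by (rule ring)
  let ?R = "\<lparr>carrier = carrier R, mult = undefined, one = undefined, zero = \<zero>\<^bsub>R\<^esub>,
    add = add R, ract = mult R\<rparr> :: ('a, 'a) rmodule"
  have reg: "right_module R ?R"
  proof (rule right_moduleI)
    show "\<exists>y\<in>carrier ?R. y \<oplus>\<^bsub>?R\<^esub> x = \<zero>\<^bsub>?R\<^esub>" if "x \<in> carrier ?R" for x
      using that R.l_neg by (intro bexI[of _ "\<ominus>\<^bsub>R\<^esub> x"]) auto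
  qed (auto simp: R.ring_axioms R.a_ac R.l_distr R.r_distr R.m_assoc)
  have "usmall (carrier ?R)"
    using module_universe by (simp add: module_universe_def small_in_def)
  then obtain A :: "('a, 'u) rmodule" and r where A: "A \<in> MOD" and r: "r \<in> riso R ?R A"
    using small_copy[OF reg] by blast
  let ?s = "inv_into (carrier R) r"
  have s: "?s \<in> rhom R A ?R"
    using riso_inv[OF reg r] by (simp add: riso_def)
  have rh: "r \<in> rhom R ?R A" and rb: "bij_betw r (carrier R) (carrier A)"
    using r by (auto simp: riso_def)
  have sr: "?s (r a) = a" if "a \<in> carrier R" for a
    using rb that by (simp add: bij_betw_def)
  show ?thesis
  proof (rule that[OF A])
    show "r \<one>\<^bsub>R\<^esub> \<in> carrier A"
      using rb R.one_closed by (auto simp: bij_betw_def)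
    show "\<forall>y\<in>carrier A. \<exists>a\<in>carrier R. y = r \<one>\<^bsub>R\<^esub> \<odot>\<^bsub>A\<^esub> a"
    proof
      fix y assume "y \<in> carrier A"
      then obtain a where a: "a \<in> carrier R" "y = r a"
        using rb by (auto simp: bij_betw_def)
      then show "\<exists>a\<in>carrier R. y = r \<one>\<^bsub>R\<^esub> \<odot>\<^bsub>A\<^esub> a"
        using rhom_ract[OF rh, of "\<one>\<^bsub>R\<^esub>" a] by (intro bexI[of _ a]) simp_all
    qed
    show "\<forall>N\<in>MOD. \<forall>n\<in>carrier N. \<exists>f\<in>rhom R A N. f (r \<one>\<^bsub>R\<^esub>) = n"
    proof (intro ballI)
      fix N :: "('a, 'u) rmodule" and n assume N: "N \<in> MOD" and n: "n \<in> carrier N"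
      interpret N: right_module R N by (rule ModD(1)[OF N])
      have "(\<lambda>a. n \<odot>\<^bsub>N\<^esub> a) \<in> rhom R ?R N"
        using n by (intro rhomI) (auto simp: N.ract_closed N.ract_add N.ract_mult)
      from rhom_comp[OF s this] show "\<exists>f\<in>rhom R A N. f (r \<one>\<^bsub>R\<^esub>) = n"
        by (rule bexI[rotated]) (simp add: sr n N.ract_one)
    qed
  qed
qed

end

definition cyclic_cokernel ::
  "'a ring \<Rightarrow> ('a, 'u) rmodule \<Rightarrow> 'u \<Rightarrow> ('u \<Rightarrow> 'u) \<Rightarrow> ('a, 'u) rmodule \<Rightarrow> bool" where
  "cyclic_cokernel R T x \<psi> C \<longleftrightarrow> \<psi> \<in> repi R T C \<and> rkernel T C \<psi> = {x \<odot>\<^bsub>T\<^esub> a |a. a \<in> carrier R}"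

context torsion_theory
begin

lemma cyclic_cokernel_factor:
  assumes T: "T \<in> MOD" and C: "C \<in> MOD" and x: "x \<in> carrier T" and coker: "cyclic_cokernel R T x \<psi> C"
    and N: "right_module R N" and f: "f \<in> rhom R T N" "f x = \<zero>\<^bsub>N\<^esub>"
  shows "\<exists>g\<in>rhom R C N. \<forall>y\<in>carrier T. g (\<psi> y) = f y"
proof (rule factor_through_epi[OF ModD(1)[OF T] ModD(1)[OF C] N _ f(1)])
  interpret N: right_module R N by (rule N)
  show "\<psi> \<in> repi R T C"
    using coker by (simp add: cyclic_cokernel_def)
  fix y assume "y \<in> carrier T" "\<psi> y = \<zero>\<^bsub>C\<^esub>"
  then have "y \<in> rkernel T C \<psi>" by (simp add: rkernel_def)
  then obtain a where "a \<in> carrier R" "y = x \<odot>\<^bsub>T\<^esub> a"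
    using coker unfolding cyclic_cokernel_def by blast
  then show "f y = \<zero>\<^bsub>N\<^esub>"
    by (simp add: rhom_ract[OF f(1) x] f(2))
qed

lemma versal_from_approximations:
  assumes approx: "\<forall>M\<in>MOD. \<exists>B\<in>MOD. \<exists>C\<in>MOD. \<exists>\<phi> \<psi>. right_exact R M \<phi> B \<psi> C \<and>
    left_approximation R \<T> M \<phi> B \<and> Ext_projective R \<T> C"
  shows "\<exists>T C x \<psi>. versal R \<T> T x \<and> Ext_projective R \<T> C \<and> cyclic_cokernel R T x \<psi> C"
proof -
  obtain A :: "('a, 'u) rmodule" and u where A: "A \<in> MOD" and u: "u \<in> carrier A"
    and span: "\<forall>y\<in>carrier A. \<exists>a\<in>carrier R. y = u \<odot>\<^bsub>A\<^esub> a"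
    and free: "\<forall>N\<in>MOD. \<forall>n\<in>carrier N. \<exists>f\<in>rhom R A N. f u = n"
    by (rule regular_module, rule that)
  obtain B C \<phi> \<psi> where ex: "right_exact R A \<phi> B \<psi> C" and app: "left_approximation R \<T> A \<phi> B"
    and C: "Ext_projective R \<T> C"
    using approx A by blast
  interpret A: right_module R A by (rule ModD(1)[OF A])
  have \<phi>: "\<phi> \<in> rhom R A B"
    using app by (simp add: left_approximation_def)
  have "\<exists>g\<in>rhom R B N. g (\<phi> u) = n" if N: "N \<in> \<T>" and n: "n \<in> carrier N" for N n
  proof -
    obtain f where f: "f \<in> rhom R A N" "f u = n"
      using free T_Mod[OF N] n by blast
    obtain g where "g \<in> rhom R B N" "\<forall>x\<in>carrier A. f x = g (\<phi> x)"
      using app N f(1) unfolding left_approximation_def by blast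
    then show ?thesis using f(2) u by (intro bexI[of _ g]) simp_all
  qed
  then have "versal R \<T> B (\<phi> u)"
    using app rhom_closed[OF \<phi> u] by (simp add: versal_def left_approximation_def)
  moreover have "\<phi> ` carrier A = {\<phi> u \<odot>\<^bsub>B\<^esub> a |a. a \<in> carrier R}"
  proof
    show "\<phi> ` carrier A \<subseteq> {\<phi> u \<odot>\<^bsub>B\<^esub> a |a. a \<in> carrier R}"
    proof
      fix z assume "z \<in> \<phi> ` carrier A"
      then obtain y where y: "y \<in> carrier A" "z = \<phi> y" by blast
      then obtain a where a: "a \<in> carrier R" "y = u \<odot>\<^bsub>A\<^esub> a" using span by blast
      have "z = \<phi> u \<odot>\<^bsub>B\<^esub> a"
        unfolding y(2) a(2) by (rule rhom_ract[OF \<phi> u a(1)])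
      then show "z \<in> {\<phi> u \<odot>\<^bsub>B\<^esub> a |a. a \<in> carrier R}" using a(1) by blast
    qed
    show "{\<phi> u \<odot>\<^bsub>B\<^esub> a |a. a \<in> carrier R} \<subseteq> \<phi> ` carrier A"
      using A.ract_closed[OF u] by (auto simp: rhom_ract[OF \<phi> u, symmetric])
  qed
  then have "cyclic_cokernel R B (\<phi> u) \<psi> C"
    using ex by (simp add: cyclic_cokernel_def right_exact_def)
  ultimately show ?thesis using C by blast
qed

text \<open>
  Let \<open>p : E \<rightarrow> T\<close> be an extension with torsion kernel. Then \<open>E\<close> is torsion, so there is \<open>g : T \<rightarrow> E\<close>
  that sends \<open>x\<close> to a preimage of \<open>x\<close>. The difference \<open>1 - p g\<close> kills \<open>x\<close>, hence factors through \<open>C\<close>, and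
  the factor lifts to \<open>E\<close>. Adding the lift to \<open>g\<close> gives a section.
\<close>

lemma versal_Ext_projective:
  assumes ver: "versal R \<T> T x" and C: "Ext_projective R \<T> C" and coker: "cyclic_cokernel R T x \<psi> C"
  shows "Ext_projective R \<T> T"
proof (rule Ext_projectiveI[OF T_subset])
  show TT: "T \<in> \<T>" using ver by (simp add: versal_def)
  have x: "x \<in> carrier T" using ver by (simp add: versal_def)
  note TM = T_Mod[OF TT] and CM = T_Mod[OF Ext_projective_in[OF C]]
  note t = ModD(1)[OF TM]
  interpret T: right_module R T by (rule t)
  have \<psi>: "\<psi> \<in> rhom R T C"
    using coker by (simp add: cyclic_cokernel_def repi_def)
  fix N E k p assume N: "N \<in> \<T>" and E: "E \<in> MOD" and ex: "short_exact R N k E p T"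
  note e = ModD(1)[OF E] and s = short_exactD[OF ex]
  have ET: "E \<in> \<T>" by (rule T_extension[OF N TT E ex])
  obtain v where v: "v \<in> carrier E" "p v = x"
    using x unfolding s(3)[symmetric] by blast
  obtain g where g: "g \<in> rhom R T E" "g x = v"
    using ver ET v(1) unfolding versal_def by blast
  have d: "(\<lambda>y. y \<ominus>\<^bsub>T\<^esub> p (g y)) \<in> rhom R T T"
    by (rule rhom_diff[OF t rhom_id rhom_comp[OF g(1) s(2)]])
  have "x \<ominus>\<^bsub>T\<^esub> p (g x) = \<zero>\<^bsub>T\<^esub>"
    using x by (simp add: g v T.minus_eq_zero_iff)
  then obtain h where h: "h \<in> rhom R C T" "\<forall>y\<in>carrier T. h (\<psi> y) = y \<ominus>\<^bsub>T\<^esub> p (g y)"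
    using cyclic_cokernel_factor[OF TM CM x coker t d] by blast
  obtain h' where h': "h' \<in> rhom R C E" "\<forall>y\<in>carrier C. p (h' y) = h y"
    using Ext_projective_lift[OF T_subset C N E TM ex h(1)] by blast
  show "\<exists>s\<in>rhom R T E. \<forall>x\<in>carrier T. p (s x) = x"
  proof (intro bexI ballI)
    show "(\<lambda>y. g y \<oplus>\<^bsub>E\<^esub> h' (\<psi> y)) \<in> rhom R T E"
      by (rule rhom_plus[OF e g(1) rhom_comp[OF \<psi> h'(1)]])
    fix y assume y: "y \<in> carrier T"
    note cl = rhom_closed[OF g(1) y] rhom_closed[OF \<psi> y] rhom_closed[OF h'(1) rhom_closed[OF \<psi> y]]
    have "p (g y \<oplus>\<^bsub>E\<^esub> h' (\<psi> y)) = p (g y) \<oplus>\<^bsub>T\<^esub> (y \<ominus>\<^bsub>T\<^esub> p (g y))"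
      using cl y h h' by (simp add: rhom_add[OF s(2)])
    also have "\<dots> = y"
      using y rhom_closed[OF s(2) cl(1)]
      by (simp add: a_minus_def T.M.a_lcomm[of "p (g y)"] T.M.r_neg)
    finally show "p (g y \<oplus>\<^bsub>E\<^esub> h' (\<psi> y)) = y" .
  qed
qed

text \<open>
  Used to index a direct sum by the disjoint union of two subsets of the universe.
\<close>

lemma universe_splits:
  obtains e1 e2 :: "'u \<Rightarrow> 'u" where "inj e1" "inj e2" "\<And>x y. e1 x \<noteq> e2 y"
proof -
  have "|UNIV <+> UNIV :: ('u + 'u) set| =o |UNIV :: 'u set|"
    by (rule card_of_Plus_infinite1[OF infinite_universe card_of_mono1[OF subset_refl]])
  then obtain e :: "'u + 'u \<Rightarrow> 'u" where "bij_betw e (UNIV <+> UNIV) UNIV"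
    using card_of_ordIso by blast
  then have e: "inj e" by (simp add: bij_betw_def)
  show ?thesis
    by (rule that[of "\<lambda>x. e (Inl x)" "\<lambda>x. e (Inr x)"]) (use e in \<open>auto simp: inj_def\<close>)
qed

text \<open>
  The sum of copies of \<open>T\<close> indexed by all homomorphisms \<open>T \<rightarrow> N\<close> would map onto \<open>N\<close> with torsion kernel,
  but these homomorphisms need not form a small set. The following economical choice works.

  Let \<open>\<pi> : B \<rightarrow> N\<close> be an epimorphism from the sum of copies of \<open>T0\<close> indexed by \<open>N\<close>, and \<open>K\<close> its kernel. As
  \<open>B\<close> is torsion, each \<open>k \<in> K\<close> is \<open>\<theta> k x\<close> for some \<open>\<theta> k : T0 \<rightarrow> B\<close>. The composite \<open>\<pi> \<circ> \<theta> k\<close> kills \<open>x\<close>, so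
  it is \<open>\<eta> k \<circ> \<psi>\<close> for some \<open>\<eta> k : T1 \<rightarrow> N\<close>. The presentation is
  \<open>T0\<^bsup>(K)\<^esup> \<rightarrow> B \<oplus> T1\<^bsup>(K)\<^esup> \<rightarrow> N \<rightarrow> 0\<close> with the maps \<open>(\<theta>, - \<psi>)\<close> and \<open>(\<pi>, \<eta>)\<close>.

  Since \<open>\<psi>\<close> is surjective, an element of the middle term can be moved into \<open>B\<close> by subtracting an
  element of the image of the first map. If it lies in the kernel of the second map, it ends up in \<open>K\<close>,
  and \<open>k \<in> K\<close> is the image of \<open>x\<close> in the summand \<open>k\<close> because \<open>\<psi> x = 0\<close>.
\<close>

lemma presentation:
  assumes ver: "versal R \<T> T0 x" and T1: "Ext_projective R \<T> T1"
    and coker: "cyclic_cokernel R T0 x \<psi> T1"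
    and T: "T \<in> MOD" and bip: "biproduct R T0 T1 T i0 i1 p0 p1" and N: "N \<in> \<T>"
  shows "N \<in> Pres R T"
proof -
  have T0: "T0 \<in> \<T>" and x: "x \<in> carrier T0"
    and gen: "\<And>N n. N \<in> \<T> \<Longrightarrow> n \<in> carrier N \<Longrightarrow> \<exists>g\<in>rhom R T0 N. g x = n"
    using ver by (auto simp: versal_def)
  note bi = biproductD[OF bip]
  note T0M = T_Mod[OF T0] and T1M = T_Mod[OF Ext_projective_in[OF T1]] and NM = T_Mod[OF N]
  note t0 = ModD(1)[OF T0M] and t1 = ModD(1)[OF T1M] and nm = ModD[OF NM]
  interpret T0: right_module R T0 by (rule t0)
  interpret T1: right_module R T1 by (rule t1)
  interpret N: right_module R N by (rule nm)
  have \<psi>: "\<psi> \<in> rhom R T0 T1" and \<psi>i: "\<psi> ` carrier T0 = carrier T1"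
    using coker by (auto simp: cyclic_cokernel_def repi_def)
  have "x \<in> rkernel T0 T1 \<psi>"
    using coker T0.ract_one[OF x, symmetric] T0.R.one_closed unfolding cyclic_cokernel_def by blast
  then have \<psi>x: "\<psi> x = \<zero>\<^bsub>T1\<^esub>" by (simp add: rkernel_def)

  obtain B :: "('a, 'u) rmodule" and \<iota> where B: "B \<in> MOD" and copB: "coproduct R (carrier N) (\<lambda>_. T0) B \<iota>"
    using coproduct_exists[OF nm(2), of "\<lambda>_. T0"] T0M by blast
  note bm = ModD[OF B]
  interpret B: right_module R B by (rule bm)
  have BT: "B \<in> \<T>"
    by (rule T_coproduct[OF nm(2) _ B copB]) (rule T0)
  obtain h where h: "\<And>n. n \<in> carrier N \<Longrightarrow> h n \<in> rhom R T0 N"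
    and hx: "\<And>n. n \<in> carrier N \<Longrightarrow> h n x = n"
    using gen[OF N] by metis
  obtain \<pi> where \<pi>: "\<pi> \<in> rhom R B N" "\<forall>n\<in>carrier N. \<forall>t\<in>carrier T0. \<pi> (\<iota> n t) = h n t"
    using coproduct_universal[OF copB nm(1), where f = h, OF h] by blast
  define K where "K = rkernel B N \<pi>"
  have KB: "k \<in> carrier B" and K\<pi>: "\<pi> k = \<zero>\<^bsub>N\<^esub>" if "k \<in> K" for k
    using that by (auto simp: K_def rkernel_def)
  have Ks: "usmall K"
    using bm(2) by (rule usmall_subset) (auto simp: K_def rkernel_def)
  have "\<exists>g\<in>rhom R T0 B. g x = k" if "k \<in> K" for k
    by (rule gen[OF BT KB[OF that]])
  then obtain \<theta> where \<theta>: "\<And>k. k \<in> K \<Longrightarrow> \<theta> k \<in> rhom R T0 B" and \<theta>x: "\<And>k. k \<in> K \<Longrightarrow> \<theta> k x = k"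
    by metis
  have "\<exists>g\<in>rhom R T1 N. \<forall>y\<in>carrier T0. g (\<psi> y) = \<pi> (\<theta> k y)" if "k \<in> K" for k
    by (rule cyclic_cokernel_factor[OF T0M T1M x coker nm(1) rhom_comp[OF \<theta>[OF that] \<pi>(1)]])
      (simp add: \<theta>x K\<pi> that)
  then obtain \<eta> where \<eta>: "\<And>k. k \<in> K \<Longrightarrow> \<eta> k \<in> rhom R T1 N"
    and \<eta>\<psi>: "\<And>k y. k \<in> K \<Longrightarrow> y \<in> carrier T0 \<Longrightarrow> \<eta> k (\<psi> y) = \<pi> (\<theta> k y)"
    by metis

  \<comment> \<open>The middle term \<open>M0\<close> as a single sum: \<open>T0\<close> over \<open>N\<close> and \<open>T1\<close> over \<open>K\<close>.\<close>
  obtain e1 e2 :: "'u \<Rightarrow> 'u" where e: "inj e1" "inj e2" "\<And>x y. e1 x \<noteq> e2 y"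
    by (rule universe_splits) blast
  define F where "F j = (if j \<in> range e1 then T0 else T1)" for j
  have F1: "F (e1 n) = T0" and F2: "F (e2 n) = T1" for n
    using e(3) by (auto simp: F_def) (metis e(3))
  define J where "J = e1 ` carrier N \<union> e2 ` K"
  have Js: "usmall J"
    unfolding J_def by (intro usmall_Un usmall_image nm(2) Ks)
  have J1: "e1 n \<in> J" if "n \<in> carrier N" for n using that by (simp add: J_def)
  have J2: "e2 k \<in> J" if "k \<in> K" for k using that by (simp add: J_def)
  have FM: "F j \<in> MOD" for j
    using T0M T1M by (simp add: F_def)
  obtain M0 :: "('a, 'u) rmodule" and \<kappa> where M0: "M0 \<in> MOD" and cop0: "coproduct R J F M0 \<kappa>"
    using coproduct_exists[OF Js, of F] FM by blast
  note m0 = ModD(1)[OF M0]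
  interpret M0: right_module R M0 by (rule m0)
  have \<kappa>1: "\<kappa> (e1 n) \<in> rhom R T0 M0" if "n \<in> carrier N" for n
    using coproduct_injection[OF cop0 J1[OF that]] by (simp add: F1)
  have \<kappa>2: "\<kappa> (e2 k) \<in> rhom R T1 M0" if "k \<in> K" for k
    using coproduct_injection[OF cop0 J2[OF that]] by (simp add: F2)
  have M0_add: "M0 \<in> Add R T"
  proof (rule Add_coproduct[OF T M0 Js cop0])
    show "(if j \<in> range e1 then i0 else i1) \<in> rhom R (F j) T" for j
      using bi by (simp add: F_def)
    show "(if j \<in> range e1 then p0 else p1) \<in> rhom R T (F j)" for j
      using bi by (simp add: F_def)
    show "(if j \<in> range e1 then p0 else p1) ((if j \<in> range e1 then i0 else i1) t) = t"
      if "t \<in> carrier (F j)" for j t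
      using bi that by (auto simp: F_def split: if_splits)
  qed
  obtain M1 :: "('a, 'u) rmodule" and \<mu> where M1: "M1 \<in> MOD" and cop1: "coproduct R K (\<lambda>_. T0) M1 \<mu>"
    using coproduct_exists[OF Ks, of "\<lambda>_. T0"] T0M by blast
  note m1 = ModD(1)[OF M1]
  interpret M1: right_module R M1 by (rule m1)
  have \<mu>: "\<mu> k \<in> rhom R T0 M1" if "k \<in> K" for k
    by (rule coproduct_injection[OF cop1 that])
  have M1_add: "M1 \<in> Add R T"
    by (rule Add_coproduct[OF T M1 Ks cop1, of "\<lambda>_. i0" "\<lambda>_. p0"]) (use bi in auto)

  \<comment> \<open>\<open>\<beta>\<close> is the inclusion of \<open>B\<close> into \<open>M0\<close>, and \<open>f\<close> combines the components of \<open>(\<pi>, \<eta>)\<close>.\<close>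
  obtain \<beta> where \<beta>: "\<beta> \<in> rhom R B M0" "\<forall>n\<in>carrier N. \<forall>t\<in>carrier T0. \<beta> (\<iota> n t) = \<kappa> (e1 n) t"
    using coproduct_universal[OF copB m0, where f = "\<lambda>n. \<kappa> (e1 n)", OF \<kappa>1] by blast
  define f where "f j = (if j \<in> range e1 then h (inv_into UNIV e1 j) else \<eta> (inv_into UNIV e2 j))" for j
  have f1: "f (e1 n) = h n" and f2: "f (e2 n) = \<eta> n" for n
    using e(3) by (auto simp: f_def inv_f_f[OF e(1)] inv_f_f[OF e(2)]) (metis e(3))
  have "f j \<in> rhom R (F j) N" if "j \<in> J" for j
    using that h \<eta> by (auto simp: J_def f1 f2 F1 F2)
  then obtain \<rho> where \<rho>: "\<rho> \<in> rhom R M0 N" "\<forall>j\<in>J. \<forall>t\<in>carrier (F j). \<rho> (\<kappa> j t) = f j t"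
    using coproduct_universal[OF cop0 nm(1), of f] by blast
  have \<rho>1: "\<rho> (\<kappa> (e1 n) t) = h n t" if "n \<in> carrier N" "t \<in> carrier T0" for n t
    using \<rho>(2) J1[OF that(1)] that(2) f1 F1 by metis
  have \<rho>2: "\<rho> (\<kappa> (e2 k) t) = \<eta> k t" if "k \<in> K" "t \<in> carrier T1" for k t
    using \<rho>(2) J2[OF that(1)] that(2) f2 F2 by metis
  have \<rho>\<beta>: "\<rho> (\<beta> b) = \<pi> b" if "b \<in> carrier B" for b
    by (rule coproduct_rhom_eq[OF copB bm(1) nm(1) rhom_comp[OF \<beta>(1) \<rho>(1)] \<pi>(1) _ that])
      (simp add: \<beta> \<rho>1 \<pi>)
  have "(\<lambda>s. \<beta> (\<theta> k s) \<ominus>\<^bsub>M0\<^esub> \<kappa> (e2 k) (\<psi> s)) \<in> rhom R T0 M0" if "k \<in> K" for k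
    by (rule rhom_diff[OF m0 rhom_comp[OF \<theta>[OF that] \<beta>(1)] rhom_comp[OF \<psi> \<kappa>2[OF that]]])
  then obtain \<alpha> where \<alpha>: "\<alpha> \<in> rhom R M1 M0"
    "\<forall>k\<in>K. \<forall>s\<in>carrier T0. \<alpha> (\<mu> k s) = \<beta> (\<theta> k s) \<ominus>\<^bsub>M0\<^esub> \<kappa> (e2 k) (\<psi> s)"
    using coproduct_universal[OF cop1 m0, of "\<lambda>k s. \<beta> (\<theta> k s) \<ominus>\<^bsub>M0\<^esub> \<kappa> (e2 k) (\<psi> s)"] by blast
  note cl = rhom_closed[OF \<alpha>(1)] rhom_closed[OF \<beta>(1)] rhom_closed[OF \<rho>(1)] rhom_closed[OF \<pi>(1)]
    rhom_closed[OF \<psi>] rhom_closed[OF \<theta>] rhom_closed[OF \<mu>] rhom_closed[OF \<kappa>1] rhom_closed[OF \<kappa>2]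
  have \<rho>\<alpha>: "\<rho> (\<alpha> s) = \<zero>\<^bsub>N\<^esub>" if "s \<in> carrier M1" for s
  proof (rule coproduct_rhom_eq[OF cop1 m1 nm(1) rhom_comp[OF \<alpha>(1) \<rho>(1)] rhom_const_zero[OF nm(1)] _ that])
    show "\<rho> (\<alpha> (\<mu> k t)) = \<zero>\<^bsub>N\<^esub>" if "k \<in> K" "t \<in> carrier T0" for k t
      using that by (simp add: \<alpha> rhom_minus[OF m0 nm(1) \<rho>(1)] cl \<rho>\<beta> \<rho>2 \<eta>\<psi> N.minus_eq_zero_iff)
  qed
  have decomp: "\<exists>b\<in>carrier B. \<exists>s\<in>carrier M1. z = \<beta> b \<oplus>\<^bsub>M0\<^esub> \<alpha> s" if "z \<in> carrier M0" for z
    using cop0 that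
  proof (rule coproduct_induct)
    show "\<exists>b\<in>carrier B. \<exists>s\<in>carrier M1. \<zero>\<^bsub>M0\<^esub> = \<beta> b \<oplus>\<^bsub>M0\<^esub> \<alpha> s"
      by (intro bexI[of _ "\<zero>\<^bsub>B\<^esub>"] bexI[of _ "\<zero>\<^bsub>M1\<^esub>"])
        (simp_all add: rhom_zero[OF bm(1) m0 \<beta>(1)] rhom_zero[OF m1 m0 \<alpha>(1)])
  next
    fix y z assume "\<exists>b\<in>carrier B. \<exists>s\<in>carrier M1. y = \<beta> b \<oplus>\<^bsub>M0\<^esub> \<alpha> s"
      "\<exists>b\<in>carrier B. \<exists>s\<in>carrier M1. z = \<beta> b \<oplus>\<^bsub>M0\<^esub> \<alpha> s"
    then obtain b s b' s' where bs: "b \<in> carrier B" "s \<in> carrier M1" "y = \<beta> b \<oplus>\<^bsub>M0\<^esub> \<alpha> s"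
      "b' \<in> carrier B" "s' \<in> carrier M1" "z = \<beta> b' \<oplus>\<^bsub>M0\<^esub> \<alpha> s'"
      by blast
    then show "\<exists>b\<in>carrier B. \<exists>s\<in>carrier M1. y \<oplus>\<^bsub>M0\<^esub> z = \<beta> b \<oplus>\<^bsub>M0\<^esub> \<alpha> s"
      by (intro bexI[of _ "b \<oplus>\<^bsub>B\<^esub> b'"] bexI[of _ "s \<oplus>\<^bsub>M1\<^esub> s'"])
        (simp_all add: rhom_add[OF \<beta>(1)] rhom_add[OF \<alpha>(1)] cl M0.M.a_ac)
  next
    fix j t assume j: "j \<in> J" and t: "t \<in> carrier (F j)"
    then consider n where "n \<in> carrier N" "j = e1 n" | k where "k \<in> K" "j = e2 k"
      by (auto simp: J_def)
    then show "\<exists>b\<in>carrier B. \<exists>s\<in>carrier M1. \<kappa> j t = \<beta> b \<oplus>\<^bsub>M0\<^esub> \<alpha> s"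
    proof cases
      case 1
      then have t0: "t \<in> carrier T0" using t by (simp add: F1)
      have b: "\<iota> n t \<in> carrier B"
        by (rule rhom_closed[OF coproduct_injection[OF copB 1(1)] t0])
      have "\<kappa> j t = \<beta> (\<iota> n t) \<oplus>\<^bsub>M0\<^esub> \<alpha> \<zero>\<^bsub>M1\<^esub>"
        using 1 t0 cl(8) \<beta>(2) by (simp add: rhom_zero[OF m1 m0 \<alpha>(1)])
      then show ?thesis
        using b M1.M.zero_closed by (intro bexI[of _ "\<iota> n t"] bexI[of _ "\<zero>\<^bsub>M1\<^esub>"])
    next
      case 2
      then have "t \<in> carrier T1" using t by (simp add: F2)
      then obtain y where y: "y \<in> carrier T0" "t = \<psi> y"
        unfolding \<psi>i[symmetric] by blast
      have c: "\<theta> k y \<in> carrier B" "\<mu> k y \<in> carrier M1" "\<kappa> (e2 k) t \<in> carrier M0"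
        using cl(6,7,9) 2(1) y cl(5) by auto
      have "\<beta> (\<theta> k y) \<oplus>\<^bsub>M0\<^esub> \<alpha> (\<ominus>\<^bsub>M1\<^esub> \<mu> k y) =
          \<beta> (\<theta> k y) \<oplus>\<^bsub>M0\<^esub> \<ominus>\<^bsub>M0\<^esub> (\<beta> (\<theta> k y) \<ominus>\<^bsub>M0\<^esub> \<kappa> (e2 k) t)"
        using 2(1) y c by (simp add: rhom_neg[OF m1 m0 \<alpha>(1)] \<alpha>(2))
      also have "\<dots> = \<kappa> j t"
        using c cl(2) 2(2) by (simp add: a_minus_def M0.M.minus_add M0.M.r_neg1 M0.M.r_neg2)
      finally show ?thesis
        using c by (intro bexI[of _ "\<theta> k y"] bexI[of _ "\<ominus>\<^bsub>M1\<^esub> \<mu> k y"]) (simp_all add: M1.M.a_inv_closed)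
    qed
  qed (rule m0)
  have kernel: "rkernel M0 N \<rho> \<subseteq> \<alpha> ` carrier M1"
  proof
    fix z assume z: "z \<in> rkernel M0 N \<rho>"
    then have zc: "z \<in> carrier M0" and z0: "\<rho> z = \<zero>\<^bsub>N\<^esub>" by (auto simp: rkernel_def)
    obtain b s where bs: "b \<in> carrier B" "s \<in> carrier M1" "z = \<beta> b \<oplus>\<^bsub>M0\<^esub> \<alpha> s"
      using decomp[OF zc] by blast
    have "\<pi> b = \<zero>\<^bsub>N\<^esub>"
      using z0 bs by (simp add: rhom_add[OF \<rho>(1)] cl \<rho>\<beta> \<rho>\<alpha>)
    then have k: "b \<in> K" using bs(1) by (simp add: K_def rkernel_def)
    have "\<alpha> (\<mu> b x) = \<beta> b"
      using \<alpha>(2) k x bs(1) by (simp add: \<theta>x \<psi>x rhom_zero[OF t1 m0 \<kappa>2[OF k]] a_minus_def M0.minus_zero cl)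
    then have "z = \<alpha> (\<mu> b x \<oplus>\<^bsub>M1\<^esub> s)"
      using bs k x by (simp add: rhom_add[OF \<alpha>(1)] cl)
    moreover have "\<mu> b x \<oplus>\<^bsub>M1\<^esub> s \<in> carrier M1"
      using bs k x by (simp add: cl)
    ultimately show "z \<in> \<alpha> ` carrier M1" by (rule image_eqI)
  qed
  have "right_exact R M1 \<alpha> M0 \<rho> N"
    unfolding right_exact_def repi_def
  proof (intro conjI CollectI \<alpha>(1) \<rho>(1) subset_antisym kernel)
    show "\<rho> ` carrier M0 \<subseteq> carrier N" using cl(3) by blast
    show "carrier N \<subseteq> \<rho> ` carrier M0"
    proof
      fix n assume n: "n \<in> carrier N"
      have "n = \<rho> (\<kappa> (e1 n) x)" using \<rho>1[OF n x] hx[OF n] by simp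
      then show "n \<in> \<rho> ` carrier M0" by (rule image_eqI[OF _ cl(8)[OF n x]])
    qed
    show "\<alpha> ` carrier M1 \<subseteq> rkernel M0 N \<rho>"
      using cl(1) \<rho>\<alpha> by (auto simp: rkernel_def)
  qed
  then show ?thesis
    using M1_add M0_add NM unfolding Pres_def by blast
qed

text \<open>
  The module is \<open>T0 \<oplus> T1\<close>. It is generated over its endomorphism ring by \<open>x\<close>, because each of its
  elements is the value at \<open>x\<close> of a homomorphism from the summand \<open>T0\<close>.
\<close>

lemma quasitilting_from_versal:
  assumes ver: "versal R \<T> T0 x" and T1: "Ext_projective R \<T> T1"
    and coker: "cyclic_cokernel R T0 x \<psi> T1"
  shows "\<exists>T\<in>MOD. finendo R T \<and> quasitilting R T \<and> \<T> = Gen R T"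
proof -
  have T0T: "T0 \<in> \<T>" and x: "x \<in> carrier T0"
    and gen: "\<And>N n. N \<in> \<T> \<Longrightarrow> n \<in> carrier N \<Longrightarrow> \<exists>g\<in>rhom R T0 N. g x = n"
    using ver by (auto simp: versal_def)
  have T0: "Ext_projective R \<T> T0"
    by (rule versal_Ext_projective[OF ver T1 coker])
  obtain T :: "('a, 'u) rmodule" and i j p q where T: "T \<in> MOD" and bip: "biproduct R T0 T1 T i j p q"
    using biproduct_exists[OF T_Mod[OF T0T] T_Mod[OF Ext_projective_in[OF T1]]] by blast
  note b = biproductD[OF bip]
  interpret T: right_module R T by (rule ModD(1)[OF T])
  have proj: "Ext_projective R \<T> T"
    by (rule Ext_projective_biproduct[OF T0 T1 T bip])
  have TT: "T \<in> \<T>" by (rule Ext_projective_in[OF proj])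
  have "\<T> \<subseteq> Pres R T"
    using presentation[OF ver T1 coker T bip] by blast
  then have Gen: "\<T> = Gen R T" and Pres: "Pres R T = Gen R T"
    using Pres_subset_Gen[of T] Gen_subset[OF TT] by auto
  have "quasitilting R T"
    unfolding quasitilting_def using T Pres proj Gen by simp
  moreover have "finendo R T"
    unfolding finendo_def
  proof (intro exI[of _ "{i x}"] conjI ballI)
    show "finite {i x}" "{i x} \<subseteq> carrier T"
      using rhom_closed[OF b(1) x] by auto
    fix t assume t: "t \<in> carrier T"
    obtain g where g: "g \<in> rhom R T0 T" "g x = t"
      using gen[OF TT t] by blast
    show "\<exists>h\<in>{i x} \<rightarrow> rhom R T T. t = (\<Oplus>\<^bsub>T\<^esub>y\<in>{i x}. h y y)"
    proof (rule bexI)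
      show "(\<lambda>_ y. g (p y)) \<in> {i x} \<rightarrow> rhom R T T"
        using rhom_comp[OF b(3) g(1)] by simp
      show "t = (\<Oplus>\<^bsub>T\<^esub>y\<in>{i x}. g (p y))"
        using t by (simp add: b(5)[OF x] g)
    qed
  qed
  ultimately show ?thesis using T Gen by blast
qed

end

section \<open>Torsion classes with Ext-projective cokernels of approximations\<close>

theorem theorem3p6:
  fixes A :: "'a ring" and \<T> :: "('a, 'u) rmodule set"
  assumes "ring A"
    and "module_universe A TYPE('u)"
    and "torsion_class A \<T>"
  shows "(\<forall>M\<in>Mod A. \<exists>B\<in>Mod A. \<exists>C\<in>Mod A. \<exists>\<phi> \<psi>.
            right_exact A M \<phi> B \<psi> C \<and> left_approximation A \<T> M \<phi> B \<and> Ext_projective A \<T> C)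
         \<longleftrightarrow>
         (\<exists>T\<in>Mod A. finendo A T \<and> quasitilting A T \<and> \<T> = Gen A T)"
proof -
  interpret torsion_theory A "TYPE('u)" \<T>
    using assms
    by (intro torsion_theory.intro module_category.intro torsion_theory_axioms.intro)
  show ?thesis
  proof
    assume "\<forall>M\<in>Mod A. \<exists>B\<in>Mod A. \<exists>C\<in>Mod A. \<exists>\<phi> \<psi>.
            right_exact A M \<phi> B \<psi> C \<and> left_approximation A \<T> M \<phi> B \<and> Ext_projective A \<T> C"
    then obtain T0 T1 x \<psi> where "versal A \<T> T0 x" "Ext_projective A \<T> T1" "cyclic_cokernel A T0 x \<psi> T1"
      using versal_from_approximations by blast
    then show "\<exists>T\<in>Mod A. finendo A T \<and> quasitilting A T \<and> \<T> = Gen A T"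
      by (rule quasitilting_from_versal)
  next
    assume "\<exists>T\<in>Mod A. finendo A T \<and> quasitilting A T \<and> \<T> = Gen A T"
    then obtain T where T: "finendo A T" "Ext_projective A \<T> T" "\<T> = Gen A T"
      by (auto simp: quasitilting_def)
    obtain T' x where T': "Ext_projective A \<T> T'" "versal A \<T> T' x"
      using versal_from_finendo[OF T] by blast
    show "\<forall>M\<in>Mod A. \<exists>B\<in>Mod A. \<exists>C\<in>Mod A. \<exists>\<phi> \<psi>.
            right_exact A M \<phi> B \<psi> C \<and> left_approximation A \<T> M \<phi> B \<and> Ext_projective A \<T> C"
      using approximation_from_versal[OF T'] by (intro ballI)
  qed
qed

end
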